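(* Let $a>0$ and let $W^a=(W^a_t:t\in[0,1])$ be the centered Gaussian process with covariance kernel $G_a(t,t')=\exp\{-4a^2\sin^2(\pi t-\pi t')\}$. The RKHS $\mathbb{H}^a$ of $W^a$ is the set of real parts of all functions in $$\Big\{h:[0,1]\to\mathbb{C},\ h(t)=\sum_{n=-\infty}^\infty e^{-it2\pi n}b_{n,a}e^{-2a^2}I_n(2a^2):\ b_{n,a}\in\mathbb{C},\ \sum_{n=-\infty}^\infty|b_{n,a}|^2e^{-2a^2}I_n(2a^2)<\infty\Big\},$$ and it is equipped with the squared norm $$\|h\|_{\mathbb{H}^a}^2=\sum_{n=-\infty}^\infty|b_{n,a}|^2e^{-2a^2}I_n(2a^2)=\sum_{n=-\infty}^\infty\frac{1}{e^{-2a^2}I_n(2a^2)}\left|\int_0^1h(t)e^{it2\pi n}dt\right|^2,$$ where, for a (real-valued) element $h\in\mathbb{H}^a$, $b_{n,a}$ are the coefficients of its own expansion $h(t)=\sum_ne^{-it2\pi n}b_{n,a}e^{-2a^2}I_n(2a^2)$.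
   Context: $I_n(x)$ denotes the modified Bessel function of the first kind of integer order $n$. RKHS means reproducing kernel Hilbert space. *)

theory Defs
  imports "HOL-Probability.Probability"
begin

text \<open>
  The series for the modified Bessel function of the first kind of integer order. For negative
  order it still makes sense because \<^term>\<open>rGamma\<close>, the reciprocal of the Gamma function, vanishes
  at the non-positive integers.
\<close>

definition bessel_I :: "int \<Rightarrow> real \<Rightarrow> real" where
  "bessel_I n x = (\<Sum>m. rGamma (of_int (int m + n + 1)) / fact m * (x / 2) powi (2 * int m + n))"


text \<open>The first alternative admits degenerate (almost surely constant) normal variables.\<close>

definition gaussian_variable :: "'w measure \<Rightarrow> ('w \<Rightarrow> real) \<Rightarrow> bool" where
  "gaussian_variable M X \<longleftrightarrow> X \<in> borel_measurable M \<and>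
     ((\<exists>\<mu>. AE \<omega> in M. X \<omega> = \<mu>) \<or>
      (\<exists>\<mu> \<sigma>. \<sigma> > 0 \<and> distributed M lborel X (\<lambda>x. ennreal (normal_density \<mu> \<sigma> x))))"

definition process_span :: "'t set \<Rightarrow> ('t \<Rightarrow> 'w \<Rightarrow> real) \<Rightarrow> ('w \<Rightarrow> real) set" where
  "process_span T W = {(\<lambda>\<omega>. \<Sum>t\<in>F. c t * W t \<omega>) | F c. finite F \<and> F \<subseteq> T}"

definition gaussian_process :: "'w measure \<Rightarrow> 't set \<Rightarrow> ('t \<Rightarrow> 'w \<Rightarrow> real) \<Rightarrow> bool" where
  "gaussian_process M T W \<longleftrightarrow> prob_space M \<and> (\<forall>X\<in>process_span T W. gaussian_variable M X)"

definition centered_gaussian_process ::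
    "'w measure \<Rightarrow> 't set \<Rightarrow> ('t \<Rightarrow> 'w \<Rightarrow> real) \<Rightarrow> ('t \<Rightarrow> 't \<Rightarrow> real) \<Rightarrow> bool" where
  "centered_gaussian_process M T W K \<longleftrightarrow> gaussian_process M T W \<and>
     (\<forall>t\<in>T. (\<integral>\<omega>. W t \<omega> \<partial>M) = 0) \<and>
     (\<forall>s\<in>T. \<forall>t\<in>T. (\<integral>\<omega>. W s \<omega> * W t \<omega> \<partial>M) = K s t)"


text \<open>
  The RKHS of a centered process \<open>W\<close> indexed by \<open>T\<close> is the completion of the space of functions
  \<open>t \<mapsto> E (W\<^sub>t X)\<close>, with \<open>X\<close> in the linear span of the \<open>W\<^sub>s\<close>, for the inner product
  \<open>\<langle>E (W X), E (W Y)\<rangle> = E (X Y)\<close>. The completion is realised as a space of functions by letting \<open>X\<close>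
  range over the closure of the span in the space of square-integrable variables. With
  \<open>X = W\<^sub>s\<close> one obtains the kernel section \<open>t \<mapsto> E (W\<^sub>t W\<^sub>s)\<close>, and the inner product of this section
  with \<open>h = E (W Y)\<close> is \<open>E (W\<^sub>s Y) = h s\<close>, which is the reproducing property.

  Functions on \<open>T\<close> are represented by functions on the whole type that are \<^term>\<open>undefined\<close>
  outside \<open>T\<close>. The choice of the representing variables does not matter in the inner product, because
  \<open>h\<close> determines its representing variable up to a null set.
\<close>

definition process_closed_span ::
    "'w measure \<Rightarrow> 't set \<Rightarrow> ('t \<Rightarrow> 'w \<Rightarrow> real) \<Rightarrow> ('w \<Rightarrow> real) set" where
  "process_closed_span M T W = {L \<in> borel_measurable M. integrable M (\<lambda>\<omega>. (L \<omega>)\<^sup>2) \<and>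
     (\<forall>\<epsilon>>0. \<exists>X\<in>process_span T W.
        integrable M (\<lambda>\<omega>. (L \<omega> - X \<omega>)\<^sup>2) \<and> (\<integral>\<omega>. (L \<omega> - X \<omega>)\<^sup>2 \<partial>M) < \<epsilon>)}"

definition rkhs_fun ::
    "'w measure \<Rightarrow> 't set \<Rightarrow> ('t \<Rightarrow> 'w \<Rightarrow> real) \<Rightarrow> ('w \<Rightarrow> real) \<Rightarrow> 't \<Rightarrow> real" where
  "rkhs_fun M T W L = (\<lambda>t\<in>T. \<integral>\<omega>. W t \<omega> * L \<omega> \<partial>M)"

definition rkhs :: "'w measure \<Rightarrow> 't set \<Rightarrow> ('t \<Rightarrow> 'w \<Rightarrow> real) \<Rightarrow> ('t \<Rightarrow> real) set" where
  "rkhs M T W = rkhs_fun M T W ` process_closed_span M T W"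

definition rkhs_inner ::
    "'w measure \<Rightarrow> 't set \<Rightarrow> ('t \<Rightarrow> 'w \<Rightarrow> real) \<Rightarrow> ('t \<Rightarrow> real) \<Rightarrow> ('t \<Rightarrow> real) \<Rightarrow> real" where
  "rkhs_inner M T W g h = (THE r. \<exists>X\<in>process_closed_span M T W. \<exists>Y\<in>process_closed_span M T W.
     g = rkhs_fun M T W X \<and> h = rkhs_fun M T W Y \<and> r = (\<integral>\<omega>. X \<omega> * Y \<omega> \<partial>M))"

definition rkhs_norm ::
    "'w measure \<Rightarrow> 't set \<Rightarrow> ('t \<Rightarrow> 'w \<Rightarrow> real) \<Rightarrow> ('t \<Rightarrow> real) \<Rightarrow> real" where
  "rkhs_norm M T W h = sqrt (rkhs_inner M T W h h)"


definition periodic_kernel :: "real \<Rightarrow> real \<Rightarrow> real \<Rightarrow> real" where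
  "periodic_kernel a t t' = exp (- 4 * a\<^sup>2 * (sin (pi * t - pi * t'))\<^sup>2)"

definition spectral_weight :: "real \<Rightarrow> int \<Rightarrow> real" where
  "spectral_weight a n = exp (- 2 * a\<^sup>2) * bessel_I n (2 * a\<^sup>2)"

text \<open>
  \<open>b\<close> is a coefficient sequence of \<open>h\<close> on the unit interval. The doubly infinite series of complex
  numbers is read as an unconditional sum; the weighted square summability of \<open>b\<close> and the
  summability of the weights make it converge absolutely.
\<close>

definition bessel_expansion :: "real \<Rightarrow> (int \<Rightarrow> complex) \<Rightarrow> (real \<Rightarrow> complex) \<Rightarrow> bool" where
  "bessel_expansion a b h \<longleftrightarrow>
     (\<lambda>n. (cmod (b n))\<^sup>2 * spectral_weight a n) summable_on UNIV \<and>
     (\<forall>t\<in>{0..1}. ((\<lambda>n. exp (- (\<i> * of_real (t * 2 * pi * of_int n))) * b n *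
         of_real (spectral_weight a n)) has_sum h t) UNIV)"

definition bessel_space :: "real \<Rightarrow> (real \<Rightarrow> complex) set" where
  "bessel_space a = {h \<in> extensional {0..1}. \<exists>b. bessel_expansion a b h}"

end

theory Submission
  imports Defs
begin

text \<open>
  The generating function \<open>exp (x cos \<theta>) = (\<Sum>n. I\<^sub>n(x) e\<^bsup>in\<theta>\<^esup>)\<close> turns the kernel, which depends on \<open>t - t'\<close>
  only, into a Fourier series: \<open>G\<^sub>a(t, t') = (\<Sum>n. w\<^sub>n e\<^bsup>2\<pi>in(t - t')\<^esup>)\<close> with the weights
  \<open>w\<^sub>n = e\<^bsup>-2a\<^sup>2\<^esup> I\<^sub>n(2a\<^sup>2)\<close>, which are positive, symmetric in \<open>n\<close> and have the sum \<open>1\<close>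
  (\<open>spectral_weight_has_sum_kernel\<close>). So the variables \<open>W\<^sub>t\<close> have the same Gram matrix as the characters
  \<open>e\<^sub>t(n) = e\<^bsup>2\<pi>int\<^esup>\<close> in the real Hilbert space of complex sequences that are square-integrable for the
  measure \<open>w\<close> on the integers. Two families with the same Gram matrix have isometric closed linear
  spans (\<open>closed_span_isometry\<close>). Hence the RKHS consists of the functions \<open>t \<mapsto> \<langle>e\<^sub>t, b\<rangle>\<close> with \<open>b\<close> in the
  closed span of the characters, and the norm of such a function is the norm of \<open>b\<close>.

  It remains to describe that closed span. Only real coefficients are allowed in it, so all its
  elements are Hermitian, \<open>b\<^sub>-\<^sub>n = cnj b\<^sub>n\<close>. Conversely, discretising the inverse Fourier transform of a
  finitely supported Hermitian sequence gives a combination of characters that is the periodisation of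
  this sequence, and it converges to the sequence as the period grows. So the closed span contains
  every square-integrable Hermitian sequence (\<open>hermitian_in_closed_span\<close>). For Hermitian \<open>b\<close> the number
  \<open>\<langle>e\<^sub>t, b\<rangle>\<close> is the series \<open>(\<Sum>n. e\<^bsup>-2\<pi>int\<^esup> b\<^sub>n w\<^sub>n)\<close>, and taking the real part of any such series replaces \<open>b\<close>
  by its Hermitian part. This identifies the RKHS as a set of functions.

  The series converges absolutely and uniformly in \<open>t\<close>, so its Fourier coefficients are \<open>b\<^sub>n w\<^sub>n\<close>
  (\<open>bessel_expansion_fourier_coefficient\<close>). Therefore a function determines its coefficients, which gives
  the second formula for the norm and also shows that the norm does not depend on the chosen
  representing variable.
\<close>

section \<open>Square-integrable functions\<close>

text \<open>
  The values lie in a Euclidean space so that the real-valued variables of the process and the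
  complex sequences on the spectral side are instances of the same notion. The complex numbers count
  as a real inner product space here, with \<open>x \<bullet> y = Re (cnj x * y)\<close>.
\<close>

definition square_integrable :: "'a measure \<Rightarrow> ('a \<Rightarrow> 'b::euclidean_space) \<Rightarrow> bool" where
  "square_integrable M f \<longleftrightarrow> f \<in> borel_measurable M \<and> integrable M (\<lambda>x. (norm (f x))\<^sup>2)"

lemma square_integrable_measurable:
  "square_integrable M f \<Longrightarrow> f \<in> borel_measurable M"
  by (simp add: square_integrable_def)

lemma norm_add_squared_le:
  fixes u v :: "'b::real_normed_vector"
  shows "(norm (u + v))\<^sup>2 \<le> 2 * (norm u)\<^sup>2 + 2 * (norm v)\<^sup>2"
proof -
  have "(norm (u + v))\<^sup>2 \<le> (norm u + norm v)\<^sup>2"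
    by (intro power_mono norm_triangle_ineq) simp
  also have "\<dots> \<le> 2 * (norm u)\<^sup>2 + 2 * (norm v)\<^sup>2"
    using sum_squares_bound[of "norm u" "norm v"] by (simp add: power2_sum)
  finally show ?thesis .
qed

lemma square_integrable_add:
  assumes f: "square_integrable M f" and g: "square_integrable M g"
  shows "square_integrable M (\<lambda>x. f x + g x)"
proof -
  have [measurable]: "f \<in> borel_measurable M" "g \<in> borel_measurable M"
    using f g by (simp_all add: square_integrable_def)
  have "integrable M (\<lambda>x. 2 * (norm (f x))\<^sup>2 + 2 * (norm (g x))\<^sup>2)"
    using f g by (simp add: square_integrable_def)
  then have "integrable M (\<lambda>x. (norm (f x + g x))\<^sup>2)"
    by (rule Bochner_Integration.integrable_bound) (auto simp: norm_add_squared_le)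
  then show ?thesis by (simp add: square_integrable_def)
qed

lemma square_integrable_scaleR:
  assumes "square_integrable M f"
  shows "square_integrable M (\<lambda>x. c *\<^sub>R f x)"
  using assms by (auto simp: square_integrable_def power_mult_distrib)

lemma square_integrable_diff:
  assumes "square_integrable M f" and "square_integrable M g"
  shows "square_integrable M (\<lambda>x. f x - g x)"
  using square_integrable_add[OF assms(1) square_integrable_scaleR[OF assms(2), of "-1"]] by simp

lemma square_integrable_sum:
  assumes "\<And>i. i \<in> F \<Longrightarrow> square_integrable M (f i)"
  shows "square_integrable M (\<lambda>x. \<Sum>i\<in>F. f i x)"
  using assms
proof (induction F rule: infinite_finite_induct)
  case (insert i F)
  then show ?case by (simp add: square_integrable_add)
qed (simp_all add: square_integrable_def)

lemma integrable_inner: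
  assumes f: "square_integrable M f" and g: "square_integrable M g"
  shows "integrable M (\<lambda>x. f x \<bullet> g x)"
proof -
  have [measurable]: "f \<in> borel_measurable M" "g \<in> borel_measurable M"
    using f g by (simp_all add: square_integrable_def)
  have "integrable M (\<lambda>x. (norm (f x))\<^sup>2 + (norm (g x))\<^sup>2)"
    using f g by (simp add: square_integrable_def)
  then show ?thesis
  proof (rule Bochner_Integration.integrable_bound)
    have "\<bar>u \<bullet> v\<bar> \<le> (norm u)\<^sup>2 + (norm v)\<^sup>2" for u v :: 'b
      using Cauchy_Schwarz_ineq2[of u v] sum_squares_bound[of "norm u" "norm v"]
        zero_le_power2[of "norm u"] zero_le_power2[of "norm v"] by linarith
    then show "AE x in M. norm (f x \<bullet> g x) \<le> norm ((norm (f x))\<^sup>2 + (norm (g x))\<^sup>2)"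
      by simp
  qed simp
qed

lemma integrable_norm_squared:
  "square_integrable M f \<Longrightarrow> integrable M (\<lambda>x. (norm (f x))\<^sup>2)"
  by (simp add: square_integrable_def)

text \<open>
  The quadratic polynomial \<open>t \<mapsto> \<integral> \<bar>f - t g\<bar>\<^sup>2\<close> is nonnegative, so its discriminant is not positive.
\<close>

lemma Cauchy_Schwarz_integral:
  assumes f: "square_integrable M f" and g: "square_integrable M g"
  shows "(\<integral>x. f x \<bullet> g x \<partial>M)\<^sup>2 \<le> (\<integral>x. (norm (f x))\<^sup>2 \<partial>M) * (\<integral>x. (norm (g x))\<^sup>2 \<partial>M)"
proof -
  define A where "A = (\<integral>x. (norm (f x))\<^sup>2 \<partial>M)"
  define B where "B = (\<integral>x. f x \<bullet> g x \<partial>M)"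
  define C where "C = (\<integral>x. (norm (g x))\<^sup>2 \<partial>M)"
  have nonneg: "0 \<le> A - 2 * t * B + t\<^sup>2 * C" for t
  proof -
    have "0 \<le> (\<integral>x. (norm (f x - t *\<^sub>R g x))\<^sup>2 \<partial>M)" by simp
    also have "\<dots> = (\<integral>x. (norm (f x))\<^sup>2 - 2 * t * (f x \<bullet> g x) + t\<^sup>2 * (norm (g x))\<^sup>2 \<partial>M)"
      by (intro Bochner_Integration.integral_cong refl)
        (simp add: power2_norm_eq_inner inner_diff inner_commute algebra_simps power2_eq_square[of t])
    also have "\<dots> = A - 2 * t * B + t\<^sup>2 * C"
      using integrable_inner[OF f g] f g by (simp add: A_def B_def C_def square_integrable_def)
    finally show ?thesis .
  qed
  have "B\<^sup>2 \<le> A * C"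
  proof (cases "C = 0")
    case True
    have "B = 0"
    proof (rule ccontr)
      assume "B \<noteq> 0"
      then show False using nonneg[of "(A + 1) / (2 * B)"] True by simp
    qed
    then show ?thesis using True by simp
  next
    case False
    moreover have "C \<ge> 0" by (simp add: C_def)
    ultimately have "C > 0" by simp
    then show ?thesis using nonneg[of "B / C"] by (simp add: field_simps power2_eq_square)
  qed
  then show ?thesis by (simp add: A_def B_def C_def)
qed

lemma tendsto_integral_inner:
  assumes fk: "\<And>k. square_integrable M (f k)" and f: "square_integrable M f0"
    and g: "square_integrable M g"
    and lim: "(\<lambda>k::nat. \<integral>x. (norm (f k x - f0 x))\<^sup>2 \<partial>M) \<longlonglongrightarrow> 0"
  shows "(\<lambda>k. \<integral>x. g x \<bullet> f k x \<partial>M) \<longlonglongrightarrow> (\<integral>x. g x \<bullet> f0 x \<partial>M)"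
proof -
  let ?C = "\<integral>x. (norm (g x))\<^sup>2 \<partial>M"
  have "(\<lambda>k. sqrt (?C * (\<integral>x. (norm (f k x - f0 x))\<^sup>2 \<partial>M))) \<longlonglongrightarrow> sqrt (?C * 0)"
    by (rule tendsto_real_sqrt[OF tendsto_mult[OF tendsto_const lim]])
  then have bound_tendsto: "(\<lambda>k. sqrt (?C * (\<integral>x. (norm (f k x - f0 x))\<^sup>2 \<partial>M))) \<longlonglongrightarrow> 0"
    by (simp only: mult_zero_right real_sqrt_zero)
  have bound: "norm ((\<integral>x. g x \<bullet> f k x \<partial>M) - (\<integral>x. g x \<bullet> f0 x \<partial>M))
      \<le> sqrt (?C * (\<integral>x. (norm (f k x - f0 x))\<^sup>2 \<partial>M))" for k
  proof -
    have "(\<integral>x. g x \<bullet> f k x \<partial>M) - (\<integral>x. g x \<bullet> f0 x \<partial>M) = (\<integral>x. g x \<bullet> (f k x - f0 x) \<partial>M)"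
      by (simp only: inner_diff_right
          Bochner_Integration.integral_diff[OF integrable_inner[OF g fk] integrable_inner[OF g f]])
    moreover have "\<bar>\<integral>x. g x \<bullet> (f k x - f0 x) \<partial>M\<bar> \<le> sqrt (?C * (\<integral>x. (norm (f k x - f0 x))\<^sup>2 \<partial>M))"
      by (rule real_le_rsqrt)
        (simp only: power2_abs Cauchy_Schwarz_integral[OF g square_integrable_diff[OF fk[of k] f]])
    ultimately show ?thesis by (simp only: real_norm_def)
  qed
  have "(\<lambda>k. (\<integral>x. g x \<bullet> f k x \<partial>M) - (\<integral>x. g x \<bullet> f0 x \<partial>M)) \<longlonglongrightarrow> 0"
    by (rule Lim_null_comparison[OF always_eventually bound_tendsto]) (intro allI bound)
  then show ?thesis by (rule LIM_zero_cancel)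
qed

lemma tendsto_integral_norm_squared:
  assumes fk: "\<And>k. square_integrable M (f k)" and f: "square_integrable M f0"
    and lim: "(\<lambda>k::nat. \<integral>x. (norm (f k x - f0 x))\<^sup>2 \<partial>M) \<longlonglongrightarrow> 0"
  shows "(\<lambda>k. \<integral>x. (norm (f k x))\<^sup>2 \<partial>M) \<longlonglongrightarrow> (\<integral>x. (norm (f0 x))\<^sup>2 \<partial>M)"
proof -
  have "(\<integral>x. (norm (f k x))\<^sup>2 \<partial>M) = (\<integral>x. (norm (f k x - f0 x))\<^sup>2 \<partial>M)
      + 2 * (\<integral>x. f0 x \<bullet> f k x \<partial>M) - (\<integral>x. (norm (f0 x))\<^sup>2 \<partial>M)" for k
  proof -
    have "(\<integral>x. (norm (f k x - f0 x))\<^sup>2 \<partial>M)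
        = (\<integral>x. (norm (f k x))\<^sup>2 - 2 * (f0 x \<bullet> f k x) + (norm (f0 x))\<^sup>2 \<partial>M)"
      by (intro Bochner_Integration.integral_cong refl)
        (simp add: power2_norm_eq_inner inner_diff inner_commute algebra_simps)
    also have "\<dots> = (\<integral>x. (norm (f k x))\<^sup>2 \<partial>M) - 2 * (\<integral>x. f0 x \<bullet> f k x \<partial>M)
        + (\<integral>x. (norm (f0 x))\<^sup>2 \<partial>M)"
      using integrable_inner[OF f fk[of k]] fk[of k] f by (simp add: square_integrable_def)
    finally show ?thesis by simp
  qed
  moreover have "(\<lambda>k. (\<integral>x. (norm (f k x - f0 x))\<^sup>2 \<partial>M)
      + 2 * (\<integral>x. f0 x \<bullet> f k x \<partial>M) - (\<integral>x. (norm (f0 x))\<^sup>2 \<partial>M))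
     \<longlonglongrightarrow> 0 + 2 * (\<integral>x. f0 x \<bullet> f0 x \<partial>M) - (\<integral>x. (norm (f0 x))\<^sup>2 \<partial>M)"
    by (rule tendsto_diff[OF tendsto_add[OF lim tendsto_mult[OF tendsto_const
            tendsto_integral_inner[OF fk f f lim]]] tendsto_const])
  ultimately show ?thesis by (simp add: power2_norm_eq_inner)
qed

text \<open>
  A triangle inequality for the squared distance: the factor 2 is the price for avoiding square roots.
\<close>

lemma integral_norm_squared_triangle:
  assumes f: "square_integrable M f" and g: "square_integrable M g" and h: "square_integrable M h"
  shows "(\<integral>x. (norm (f x - h x))\<^sup>2 \<partial>M)
    \<le> 2 * (\<integral>x. (norm (f x - g x))\<^sup>2 \<partial>M) + 2 * (\<integral>x. (norm (g x - h x))\<^sup>2 \<partial>M)"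
proof -
  have 1: "integrable M (\<lambda>x. (norm (f x - h x))\<^sup>2)" "integrable M (\<lambda>x. (norm (f x - g x))\<^sup>2)"
    "integrable M (\<lambda>x. (norm (g x - h x))\<^sup>2)"
    by (intro integrable_norm_squared square_integrable_diff f g h)+
  have "(\<integral>x. (norm (f x - h x))\<^sup>2 \<partial>M)
      \<le> (\<integral>x. 2 * (norm (f x - g x))\<^sup>2 + 2 * (norm (g x - h x))\<^sup>2 \<partial>M)"
  proof (rule integral_mono)
    show "(norm (f x - h x))\<^sup>2 \<le> 2 * (norm (f x - g x))\<^sup>2 + 2 * (norm (g x - h x))\<^sup>2" for x
      using norm_add_squared_le[of "f x - g x" "g x - h x"] by simp
  qed (use 1 in auto)
  then show ?thesis using 1 by simp
qed

lemma (in finite_measure) integrable_square_integrable: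
  assumes f: "square_integrable M f"
  shows "integrable M f"
proof (rule Bochner_Integration.integrable_bound)
  show "integrable M (\<lambda>x. 1 + (norm (f x))\<^sup>2)"
    by (intro Bochner_Integration.integrable_add integrable_const integrable_norm_squared f)
  show "f \<in> borel_measurable M"
    by (rule square_integrable_measurable[OF f])
  have le: "norm (f x) \<le> 1 + (norm (f x))\<^sup>2" for x
    using zero_le_power2[of "norm (f x) - 1/2"] by (simp add: power2_diff power_divide)
  have "norm (f x) \<le> norm (1 + (norm (f x))\<^sup>2)" for x
    unfolding real_norm_def by (rule order_trans[OF le abs_ge_self])
  then show "AE x in M. norm (f x) \<le> norm (1 + (norm (f x))\<^sup>2)"
    by (rule AE_I2)
qed

text \<open>
  Riesz--Fischer. In a finite measure space a Cauchy sequence in mean square is Cauchy in mean, so a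
  subsequence converges almost everywhere, and Fatou's lemma along this subsequence bounds the
  distance of the whole sequence from the limit.
\<close>

lemma (in finite_measure) square_integrable_complete:
  fixes f :: "nat \<Rightarrow> 'a \<Rightarrow> 'b::euclidean_space"
  assumes sq: "\<And>k. square_integrable M (f k)"
    and cauchy: "\<And>e. e > 0 \<Longrightarrow> \<exists>N. \<forall>i\<ge>N. \<forall>j\<ge>N. (\<integral>x. (norm (f i x - f j x))\<^sup>2 \<partial>M) < e"
  obtains f0 where "square_integrable M f0"
    and "(\<lambda>k. \<integral>x. (norm (f k x - f0 x))\<^sup>2 \<partial>M) \<longlonglongrightarrow> 0"
proof -
  have [measurable]: "f k \<in> borel_measurable M" for k
    using sq[of k] by (simp add: square_integrable_def)
  have sqd: "square_integrable M (\<lambda>x. f i x - f j x)" for i j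
    by (intro square_integrable_diff sq)
  have L1: "\<exists>N. \<forall>i\<ge>N. \<forall>j\<ge>N. (\<integral>x. norm (f i x - f j x) \<partial>M) < e" if e: "e > 0" for e
  proof -
    \<comment> \<open>By Cauchy--Schwarz the square of the mean distance is at most the total mass times the mean
      square distance. The added 1 keeps the denominator positive for the zero measure.\<close>
    have D: "0 < measure M (space M) + 1" using measure_nonneg[of M "space M"] by linarith
    then have "0 < e\<^sup>2 / (measure M (space M) + 1)" using e by simp
    from cauchy[OF this] obtain N where
      N: "\<And>i j. i \<ge> N \<Longrightarrow> j \<ge> N \<Longrightarrow>
        (\<integral>x. (norm (f i x - f j x))\<^sup>2 \<partial>M) < e\<^sup>2 / (measure M (space M) + 1)" by blast
    have "(\<integral>x. norm (f i x - f j x) \<partial>M) < e" if "i \<ge> N" "j \<ge> N" for i j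
    proof -
      have n: "square_integrable M (\<lambda>x. norm (f i x - f j x))" "square_integrable M (\<lambda>x. 1 :: real)"
        using sqd[of i j] by (auto simp: square_integrable_def)
      have "(\<integral>x. norm (f i x - f j x) \<partial>M)\<^sup>2
          \<le> (\<integral>x. (norm (f i x - f j x))\<^sup>2 \<partial>M) * measure M (space M)"
        using Cauchy_Schwarz_integral[OF n] by simp
      also have "\<dots> \<le> (\<integral>x. (norm (f i x - f j x))\<^sup>2 \<partial>M) * (measure M (space M) + 1)"
        by (intro mult_left_mono) auto
      also have "\<dots> < e\<^sup>2"
        using N[OF that] D by (simp add: field_simps)
      finally show ?thesis using e by (simp add: power2_less_imp_less)
    qed
    then show ?thesis by blast
  qed
  obtain r where r: "strict_mono r" "AE x in M. Cauchy (\<lambda>i. f (r i) x)"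
    using cauchy_L1_AE_cauchy_subseq[OF integrable_square_integrable[OF sq] L1] by metis
  define f0 where "f0 x = lim (\<lambda>i. f (r i) x)" for x
  have f0m [measurable]: "f0 \<in> borel_measurable M"
    unfolding f0_def by measurable
  have conv: "AE x in M. (\<lambda>i. f (r i) x) \<longlonglongrightarrow> f0 x"
    using r(2) by eventually_elim (simp add: f0_def Cauchy_convergent_iff convergent_LIMSEQ_iff)
  have bound: "(\<integral>\<^sup>+x. ennreal ((norm (f j x - f0 x))\<^sup>2) \<partial>M) \<le> ennreal e"
    if N: "\<And>i j. i \<ge> N \<Longrightarrow> j \<ge> N \<Longrightarrow> (\<integral>x. (norm (f i x - f j x))\<^sup>2 \<partial>M) < e" and j: "j \<ge> N"
    for N j e
  proof -
    have "(\<integral>\<^sup>+x. ennreal ((norm (f j x - f0 x))\<^sup>2) \<partial>M)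
        = (\<integral>\<^sup>+x. liminf (\<lambda>i. ennreal ((norm (f j x - f (r i) x))\<^sup>2)) \<partial>M)"
    proof (rule nn_integral_cong_AE, use conv in eventually_elim)
      fix x assume "(\<lambda>i. f (r i) x) \<longlonglongrightarrow> f0 x"
      then have "(\<lambda>i. ennreal ((norm (f j x - f (r i) x))\<^sup>2)) \<longlonglongrightarrow> ennreal ((norm (f j x - f0 x))\<^sup>2)"
        by (intro tendsto_intros)
      then show "ennreal ((norm (f j x - f0 x))\<^sup>2) = liminf (\<lambda>i. ennreal ((norm (f j x - f (r i) x))\<^sup>2))"
        by (intro lim_imp_Liminf[symmetric] sequentially_bot)
    qed
    also have "\<dots> \<le> liminf (\<lambda>i. \<integral>\<^sup>+x. ennreal ((norm (f j x - f (r i) x))\<^sup>2) \<partial>M)"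
      by (intro nn_integral_liminf) measurable
    also have "\<dots> \<le> ennreal e"
    proof (intro Liminf_le eventually_sequentiallyI[of N])
      fix i assume "i \<ge> N"
      then have "r i \<ge> N" using seq_suble[OF r(1), of i] by linarith
      then show "(\<integral>\<^sup>+x. ennreal ((norm (f j x - f (r i) x))\<^sup>2) \<partial>M) \<le> ennreal e"
        using N[OF j, of "r i"] integrable_norm_squared[OF sqd[of j "r i"]]
        by (subst nn_integral_eq_integral) (auto intro: ennreal_leI)
    qed simp
    finally show ?thesis .
  qed
  have "square_integrable M (\<lambda>x. f j x - f0 x) \<and> (\<integral>x. (norm (f j x - f0 x))\<^sup>2 \<partial>M) \<le> e"
    if N: "\<And>i j. i \<ge> N \<Longrightarrow> j \<ge> N \<Longrightarrow> (\<integral>x. (norm (f i x - f j x))\<^sup>2 \<partial>M) < e" and j: "j \<ge> N"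
      and e: "e > 0" for N j e
  proof
    have b: "(\<integral>\<^sup>+x. ennreal ((norm (f j x - f0 x))\<^sup>2) \<partial>M) \<le> ennreal e"
      using bound[OF N j] .
    have int: "integrable M (\<lambda>x. (norm (f j x - f0 x))\<^sup>2)"
    proof (rule integrableI_bounded)
      show "(\<integral>\<^sup>+x. ennreal (norm ((norm (f j x - f0 x))\<^sup>2)) \<partial>M) < \<infinity>"
        using le_less_trans[OF b, of \<infinity>] by (simp only: real_norm_def abs_power2) simp
    qed measurable
    then show "square_integrable M (\<lambda>x. f j x - f0 x)"
      by (simp add: square_integrable_def)
    show "(\<integral>x. (norm (f j x - f0 x))\<^sup>2 \<partial>M) \<le> e"
    proof -
      have "(\<integral>\<^sup>+x. ennreal ((norm (f j x - f0 x))\<^sup>2) \<partial>M) = ennreal (\<integral>x. (norm (f j x - f0 x))\<^sup>2 \<partial>M)"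
        by (rule nn_integral_eq_integral[OF int]) simp
      with b have "ennreal (\<integral>x. (norm (f j x - f0 x))\<^sup>2 \<partial>M) \<le> ennreal e"
        by (simp only:)
      then show ?thesis using e by simp
    qed
  qed
  note close = this
  show thesis
  proof
    obtain N where "\<And>i j. i \<ge> N \<Longrightarrow> j \<ge> N \<Longrightarrow> (\<integral>x. (norm (f i x - f j x))\<^sup>2 \<partial>M) < 1"
      using cauchy[OF zero_less_one] by blast
    then have "square_integrable M (\<lambda>x. f N x - f0 x)"
      using close[of N 1 N] by simp
    from square_integrable_diff[OF sq[of N] this] show "square_integrable M f0" by simp
    show "(\<lambda>k. \<integral>x. (norm (f k x - f0 x))\<^sup>2 \<partial>M) \<longlonglongrightarrow> 0"
    proof (rule LIMSEQ_I)
      fix e :: real assume e: "e > 0"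
      then obtain N where "\<And>i j. i \<ge> N \<Longrightarrow> j \<ge> N \<Longrightarrow> (\<integral>x. (norm (f i x - f j x))\<^sup>2 \<partial>M) < e/2"
        using cauchy[OF half_gt_zero[OF e]] by blast
      then have "(\<integral>x. (norm (f j x - f0 x))\<^sup>2 \<partial>M) \<le> e/2" if "j \<ge> N" for j
        using close[of N "e/2" j] that e by simp
      then have "norm ((\<integral>x. (norm (f j x - f0 x))\<^sup>2 \<partial>M) - 0) < e" if "j \<ge> N" for j
        using that e by fastforce
      then show "\<exists>N. \<forall>j\<ge>N. norm ((\<integral>x. (norm (f j x - f0 x))\<^sup>2 \<partial>M) - 0) < e" by blast
    qed
  qed
qed

section \<open>Closed linear spans and isometries between them\<close>

definition lincomb :: "'t set \<Rightarrow> ('t \<Rightarrow> real) \<Rightarrow> ('t \<Rightarrow> 'a \<Rightarrow> 'b::euclidean_space) \<Rightarrow> 'a \<Rightarrow> 'b" where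
  "lincomb F c V = (\<lambda>x. \<Sum>t\<in>F. c t *\<^sub>R V t x)"

text \<open>
  The coefficients are real even when the values are complex. For the characters this is what
  restricts the closed span to Hermitian sequences.
\<close>

definition closed_span :: "'a measure \<Rightarrow> 't set \<Rightarrow> ('t \<Rightarrow> 'a \<Rightarrow> 'b::euclidean_space) \<Rightarrow> ('a \<Rightarrow> 'b) set" where
  "closed_span M T V = {f. square_integrable M f \<and> (\<forall>e>0. \<exists>F c. finite F \<and> F \<subseteq> T \<and>
     (\<integral>x. (norm (f x - lincomb F c V x))\<^sup>2 \<partial>M) < e)}"

lemma square_integrable_lincomb:
  assumes "\<And>t. t \<in> T \<Longrightarrow> square_integrable M (V t)" and "F \<subseteq> T"
  shows "square_integrable M (lincomb F c V)"
  unfolding lincomb_def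
  by (intro square_integrable_sum square_integrable_scaleR) (use assms in auto)

lemma lincomb_diff:
  assumes "finite F" "finite G"
  shows "lincomb F c V x - lincomb G d V x
    = lincomb (F \<union> G) (\<lambda>t. (if t \<in> F then c t else 0) - (if t \<in> G then d t else 0)) V x"
proof -
  have "lincomb F c V x = (\<Sum>t\<in>F \<union> G. (if t \<in> F then c t else 0) *\<^sub>R V t x)"
    unfolding lincomb_def by (intro sum.mono_neutral_cong_left) (use assms in auto)
  moreover have "lincomb G d V x = (\<Sum>t\<in>F \<union> G. (if t \<in> G then d t else 0) *\<^sub>R V t x)"
    unfolding lincomb_def by (intro sum.mono_neutral_cong_left) (use assms in auto)
  ultimately show ?thesis
    by (simp add: lincomb_def scaleR_diff_left sum_subtractf)
qed

lemma integral_inner_lincomb: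
  assumes V: "\<And>t. t \<in> T \<Longrightarrow> square_integrable M (V t)" and F: "F \<subseteq> T"
    and f: "square_integrable M f"
  shows "(\<integral>x. f x \<bullet> lincomb F c V x \<partial>M) = (\<Sum>t\<in>F. c t * (\<integral>x. f x \<bullet> V t x \<partial>M))"
proof -
  have "(\<integral>x. f x \<bullet> lincomb F c V x \<partial>M) = (\<integral>x. (\<Sum>t\<in>F. c t * (f x \<bullet> V t x)) \<partial>M)"
    by (simp only: lincomb_def inner_sum_right inner_scaleR_right)
  also have "\<dots> = (\<Sum>t\<in>F. \<integral>x. c t * (f x \<bullet> V t x) \<partial>M)"
    using F by (intro Bochner_Integration.integral_sum integrable_mult_right integrable_inner f V) auto
  finally show ?thesis by simp
qed

lemma integral_norm_squared_lincomb:
  assumes V: "\<And>t. t \<in> T \<Longrightarrow> square_integrable M (V t)" and F: "F \<subseteq> T"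
  shows "(\<integral>x. (norm (lincomb F c V x))\<^sup>2 \<partial>M)
    = (\<Sum>s\<in>F. c s * (\<Sum>t\<in>F. c t * (\<integral>x. V s x \<bullet> V t x \<partial>M)))"
proof -
  have "(\<integral>x. (norm (lincomb F c V x))\<^sup>2 \<partial>M) = (\<integral>x. lincomb F c V x \<bullet> lincomb F c V x \<partial>M)"
    by (simp only: power2_norm_eq_inner)
  also have "\<dots> = (\<Sum>s\<in>F. c s * (\<integral>x. lincomb F c V x \<bullet> V s x \<partial>M))"
    by (rule integral_inner_lincomb[OF V F square_integrable_lincomb[OF V F]])
  also have "\<dots> = (\<Sum>s\<in>F. c s * (\<integral>x. V s x \<bullet> lincomb F c V x \<partial>M))"
    by (simp only: inner_commute)
  also have "\<dots> = (\<Sum>s\<in>F. c s * (\<Sum>t\<in>F. c t * (\<integral>x. V s x \<bullet> V t x \<partial>M)))"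
  proof (rule sum.cong[OF refl])
    fix s assume "s \<in> F"
    with F have "s \<in> T" by blast
    then show "c s * (\<integral>x. V s x \<bullet> lincomb F c V x \<partial>M)
        = c s * (\<Sum>t\<in>F. c t * (\<integral>x. V s x \<bullet> V t x \<partial>M))"
      by (simp only: integral_inner_lincomb[OF V F V])
  qed
  finally show ?thesis .
qed

lemma closed_span_sequence:
  assumes "f \<in> closed_span M T V"
  obtains F c where "\<And>k::nat. finite (F k)" "\<And>k. F k \<subseteq> T"
    and "(\<lambda>k. \<integral>x. (norm (lincomb (F k) (c k) V x - f x))\<^sup>2 \<partial>M) \<longlonglongrightarrow> 0"
proof -
  have "\<exists>F c. finite F \<and> F \<subseteq> T \<and>
      (\<integral>x. (norm (f x - lincomb F c V x))\<^sup>2 \<partial>M) < inverse (real (Suc k))" for k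
    using assms unfolding closed_span_def mem_Collect_eq
    by (elim conjE allE impE) (auto simp del: of_nat_Suc)
  then obtain F c where Fc: "\<And>k. finite (F k)" "\<And>k. F k \<subseteq> T"
    "\<And>k. (\<integral>x. (norm (f x - lincomb (F k) (c k) V x))\<^sup>2 \<partial>M) < inverse (real (Suc k))"
    by metis
  have le: "norm (\<integral>x. (norm (lincomb (F k) (c k) V x - f x))\<^sup>2 \<partial>M) \<le> inverse (real (Suc k))" for k
    using Fc(3)[of k] by (simp add: norm_minus_commute)
  have "(\<lambda>k. \<integral>x. (norm (lincomb (F k) (c k) V x - f x))\<^sup>2 \<partial>M) \<longlonglongrightarrow> 0"
    by (rule Lim_null_comparison[OF always_eventually LIMSEQ_inverse_real_of_nat]) (intro allI le)
  with Fc(1,2) show thesis by (rule that)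
qed

lemma closed_spanI:
  assumes f: "square_integrable M f"
    and F: "\<And>k::nat. finite (F k)" "\<And>k. F k \<subseteq> T"
    and lim: "(\<lambda>k. \<integral>x. (norm (lincomb (F k) (c k) V x - f x))\<^sup>2 \<partial>M) \<longlonglongrightarrow> 0"
  shows "f \<in> closed_span M T V"
proof -
  have "\<exists>F c. finite F \<and> F \<subseteq> T \<and> (\<integral>x. (norm (f x - lincomb F c V x))\<^sup>2 \<partial>M) < e" if e: "e > 0" for e
  proof -
    obtain k where "norm ((\<integral>x. (norm (lincomb (F k) (c k) V x - f x))\<^sup>2 \<partial>M) - 0) < e"
      using LIMSEQ_D[OF lim e] by blast
    then have "(\<integral>x. (norm (f x - lincomb (F k) (c k) V x))\<^sup>2 \<partial>M) < e"
      by (simp add: norm_minus_commute)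
    with F show ?thesis by blast
  qed
  with f show ?thesis by (simp add: closed_span_def)
qed

lemma closed_span_closed:
  assumes V: "\<And>t. t \<in> T \<Longrightarrow> square_integrable M (V t)"
    and fk: "\<And>k::nat. f k \<in> closed_span M T V" and f: "square_integrable M f0"
    and lim: "(\<lambda>k. \<integral>x. (norm (f k x - f0 x))\<^sup>2 \<partial>M) \<longlonglongrightarrow> 0"
  shows "f0 \<in> closed_span M T V"
proof -
  have "\<exists>F c. finite F \<and> F \<subseteq> T \<and> (\<integral>x. (norm (f0 x - lincomb F c V x))\<^sup>2 \<partial>M) < e" if "e > 0" for e
  proof -
    have e4: "e / 4 > 0" using that by simp
    obtain k where "norm ((\<integral>x. (norm (f k x - f0 x))\<^sup>2 \<partial>M) - 0) < e / 4"
      using LIMSEQ_D[OF lim e4] by blast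
    then have k: "(\<integral>x. (norm (f0 x - f k x))\<^sup>2 \<partial>M) < e / 4"
      by (simp add: norm_minus_commute)
    have sq: "square_integrable M (f k)" using fk[of k] by (simp add: closed_span_def)
    obtain F c where F: "finite F" "F \<subseteq> T" "(\<integral>x. (norm (f k x - lincomb F c V x))\<^sup>2 \<partial>M) < e / 4"
      using fk[of k] e4 unfolding closed_span_def by blast
    have "(\<integral>x. (norm (f0 x - lincomb F c V x))\<^sup>2 \<partial>M) \<le> 2 * (\<integral>x. (norm (f0 x - f k x))\<^sup>2 \<partial>M)
        + 2 * (\<integral>x. (norm (f k x - lincomb F c V x))\<^sup>2 \<partial>M)"
      by (rule integral_norm_squared_triangle[OF f sq square_integrable_lincomb[OF V F(2)]])
    then have "(\<integral>x. (norm (f0 x - lincomb F c V x))\<^sup>2 \<partial>M) < e" using k F(3) by linarith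
    with F show ?thesis by blast
  qed
  with f show ?thesis by (simp add: closed_span_def)
qed

lemma closed_span_diff:
  assumes V: "\<And>t. t \<in> T \<Longrightarrow> square_integrable M (V t)"
    and f: "f \<in> closed_span M T V" and g: "g \<in> closed_span M T V"
  shows "(\<lambda>x. f x - g x) \<in> closed_span M T V"
proof -
  obtain F c where F: "\<And>k::nat. finite (F k)" "\<And>k. F k \<subseteq> T"
    and Fl: "(\<lambda>k. \<integral>x. (norm (lincomb (F k) (c k) V x - f x))\<^sup>2 \<partial>M) \<longlonglongrightarrow> 0"
    by (rule closed_span_sequence[OF f]) (rule that)
  obtain G d where G: "\<And>k::nat. finite (G k)" "\<And>k. G k \<subseteq> T"
    and Gl: "(\<lambda>k. \<integral>x. (norm (lincomb (G k) (d k) V x - g x))\<^sup>2 \<partial>M) \<longlonglongrightarrow> 0"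
    by (rule closed_span_sequence[OF g]) (rule that)
  have sf: "square_integrable M f" and sg: "square_integrable M g"
    using f g by (simp_all add: closed_span_def)
  let ?c = "\<lambda>k t. (if t \<in> F k then c k t else 0) - (if t \<in> G k then d k t else 0)"
  have "(\<integral>x. (norm (lincomb (F k \<union> G k) (?c k) V x - (f x - g x)))\<^sup>2 \<partial>M)
      \<le> 2 * (\<integral>x. (norm (lincomb (F k) (c k) V x - f x))\<^sup>2 \<partial>M)
       + 2 * (\<integral>x. (norm (lincomb (G k) (d k) V x - g x))\<^sup>2 \<partial>M)" for k
  proof -
    let ?u = "\<lambda>x. lincomb (F k) (c k) V x - f x" and ?v = "\<lambda>x. lincomb (G k) (d k) V x - g x"
    have u: "square_integrable M ?u"
      by (rule square_integrable_diff[OF square_integrable_lincomb[OF V F(2)] sf])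
    have v: "square_integrable M ?v"
      by (rule square_integrable_diff[OF square_integrable_lincomb[OF V G(2)] sg])
    have z: "square_integrable M (\<lambda>x. 0 :: 'c)" by (simp add: square_integrable_def)
    have "(\<integral>x. (norm (?u x - ?v x))\<^sup>2 \<partial>M)
        \<le> 2 * (\<integral>x. (norm (?u x - 0))\<^sup>2 \<partial>M) + 2 * (\<integral>x. (norm (0 - ?v x))\<^sup>2 \<partial>M)"
      by (rule integral_norm_squared_triangle[OF u z v])
    moreover have "lincomb (F k \<union> G k) (?c k) V x - (f x - g x) = ?u x - ?v x" for x
      by (simp only: lincomb_diff[OF F(1) G(1), symmetric]) simp
    ultimately show ?thesis by (simp only: diff_0_right diff_0 norm_minus_cancel)
  qed
  then have le: "norm (\<integral>x. (norm (lincomb (F k \<union> G k) (?c k) V x - (f x - g x)))\<^sup>2 \<partial>M)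
      \<le> 2 * (\<integral>x. (norm (lincomb (F k) (c k) V x - f x))\<^sup>2 \<partial>M)
       + 2 * (\<integral>x. (norm (lincomb (G k) (d k) V x - g x))\<^sup>2 \<partial>M)" for k
    by simp
  have "(\<lambda>k. 2 * (\<integral>x. (norm (lincomb (F k) (c k) V x - f x))\<^sup>2 \<partial>M)
       + 2 * (\<integral>x. (norm (lincomb (G k) (d k) V x - g x))\<^sup>2 \<partial>M)) \<longlonglongrightarrow> 2 * 0 + 2 * 0"
    by (rule tendsto_add[OF tendsto_mult[OF tendsto_const Fl] tendsto_mult[OF tendsto_const Gl]])
  then have lim: "(\<lambda>k. 2 * (\<integral>x. (norm (lincomb (F k) (c k) V x - f x))\<^sup>2 \<partial>M)
       + 2 * (\<integral>x. (norm (lincomb (G k) (d k) V x - g x))\<^sup>2 \<partial>M)) \<longlonglongrightarrow> 0"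
    by simp
  have "(\<lambda>k. \<integral>x. (norm (lincomb (F k \<union> G k) (?c k) V x - (f x - g x)))\<^sup>2 \<partial>M) \<longlonglongrightarrow> 0"
    by (rule Lim_null_comparison[OF always_eventually lim]) (intro allI le)
  then show ?thesis
    by (rule closed_spanI[OF square_integrable_diff[OF sf sg], rotated 2]) (use F G in auto)
qed

text \<open>
  A finite linear combination and its counterpart with the same coefficients have the same norm,
  because the norm is determined by the Gram matrix. So approximating combinations on one side yield a
  Cauchy sequence on the other side, and its limit corresponds to the given element. Applied in both
  directions, this is the Loeve isometry between the process and its spectral model.
\<close>

lemma closed_span_isometry:
  fixes V :: "'t \<Rightarrow> 'a \<Rightarrow> 'b::euclidean_space" and U :: "'t \<Rightarrow> 'c \<Rightarrow> 'd::euclidean_space"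
  assumes N: "finite_measure N"
    and V: "\<And>t. t \<in> T \<Longrightarrow> square_integrable M (V t)"
    and U: "\<And>t. t \<in> T \<Longrightarrow> square_integrable N (U t)"
    and gram: "\<And>s t. s \<in> T \<Longrightarrow> t \<in> T \<Longrightarrow> (\<integral>x. V s x \<bullet> V t x \<partial>M) = (\<integral>y. U s y \<bullet> U t y \<partial>N)"
    and f: "f \<in> closed_span M T V"
  obtains g where "g \<in> closed_span N T U"
    and "(\<integral>y. (norm (g y))\<^sup>2 \<partial>N) = (\<integral>x. (norm (f x))\<^sup>2 \<partial>M)"
    and "\<And>t. t \<in> T \<Longrightarrow> (\<integral>y. U t y \<bullet> g y \<partial>N) = (\<integral>x. V t x \<bullet> f x \<partial>M)"
proof -
  interpret N: finite_measure N by (rule N)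
  obtain F c where F: "\<And>k::nat. finite (F k)" "\<And>k. F k \<subseteq> T"
    and Fl: "(\<lambda>k. \<integral>x. (norm (lincomb (F k) (c k) V x - f x))\<^sup>2 \<partial>M) \<longlonglongrightarrow> 0"
    by (rule closed_span_sequence[OF f]) (rule that)
  let ?X = "\<lambda>k. lincomb (F k) (c k) V" and ?Y = "\<lambda>k. lincomb (F k) (c k) U"
  have sf: "square_integrable M f" using f by (simp add: closed_span_def)
  have X: "square_integrable M (?X k)" for k
    by (rule square_integrable_lincomb[OF V F(2)])
  have Y: "square_integrable N (?Y k)" for k
    by (rule square_integrable_lincomb[OF U F(2)])
  have norm_eq: "(\<integral>y. (norm (lincomb G d U y))\<^sup>2 \<partial>N) = (\<integral>x. (norm (lincomb G d V x))\<^sup>2 \<partial>M)"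
    if "G \<subseteq> T" for G d
  proof -
    have "(\<integral>y. (norm (lincomb G d U y))\<^sup>2 \<partial>N)
        = (\<Sum>s\<in>G. d s * (\<Sum>t\<in>G. d t * (\<integral>y. U s y \<bullet> U t y \<partial>N)))"
      by (rule integral_norm_squared_lincomb[OF U that])
    also have "\<dots> = (\<Sum>s\<in>G. d s * (\<Sum>t\<in>G. d t * (\<integral>x. V s x \<bullet> V t x \<partial>M)))"
      by (intro sum.cong arg_cong2[where f = "(*)"] refl gram[symmetric]) (use that in auto)
    also have "\<dots> = (\<integral>x. (norm (lincomb G d V x))\<^sup>2 \<partial>M)"
      by (rule integral_norm_squared_lincomb[OF V that, symmetric])
    finally show ?thesis .
  qed
  have dist_eq: "(\<integral>y. (norm (?Y i y - ?Y j y))\<^sup>2 \<partial>N) = (\<integral>x. (norm (?X i x - ?X j x))\<^sup>2 \<partial>M)" for i j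
    unfolding lincomb_diff[OF F(1) F(1)] by (rule norm_eq) (use F(2) in auto)
  have cauchy: "\<exists>K. \<forall>i\<ge>K. \<forall>j\<ge>K. (\<integral>y. (norm (?Y i y - ?Y j y))\<^sup>2 \<partial>N) < e" if "e > 0" for e
  proof -
    have e4: "e / 4 > 0" using that by simp
    obtain K where K: "\<And>k. k \<ge> K \<Longrightarrow> norm ((\<integral>x. (norm (?X k x - f x))\<^sup>2 \<partial>M) - 0) < e / 4"
      using LIMSEQ_D[OF Fl e4] by blast
    have "(\<integral>y. (norm (?Y i y - ?Y j y))\<^sup>2 \<partial>N) < e" if ij: "i \<ge> K" "j \<ge> K" for i j
    proof -
      have "(\<integral>x. (norm (?X i x - f x))\<^sup>2 \<partial>M) < e / 4" "(\<integral>x. (norm (f x - ?X j x))\<^sup>2 \<partial>M) < e / 4"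
        using K[OF ij(1)] K[OF ij(2)] by (simp_all add: norm_minus_commute)
      then show ?thesis
        using integral_norm_squared_triangle[OF X[of i] sf X[of j]] unfolding dist_eq by linarith
    qed
    then show ?thesis by blast
  qed
  obtain g where g: "square_integrable N g"
    and gl: "(\<lambda>k. \<integral>y. (norm (?Y k y - g y))\<^sup>2 \<partial>N) \<longlonglongrightarrow> 0"
    by (rule N.square_integrable_complete[of ?Y, OF Y cauchy], assumption, rule that)
  show thesis
  proof
    show "g \<in> closed_span N T U"
      by (rule closed_spanI[OF g F gl])
    show "(\<integral>y. (norm (g y))\<^sup>2 \<partial>N) = (\<integral>x. (norm (f x))\<^sup>2 \<partial>M)"
      using tendsto_integral_norm_squared[OF Y g gl] tendsto_integral_norm_squared[OF X sf Fl]
      unfolding norm_eq[OF F(2)] by (rule LIMSEQ_unique)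
    show "(\<integral>y. U t y \<bullet> g y \<partial>N) = (\<integral>x. V t x \<bullet> f x \<partial>M)" if t: "t \<in> T" for t
    proof -
      have eq: "(\<integral>y. U t y \<bullet> ?Y k y \<partial>N) = (\<integral>x. V t x \<bullet> ?X k x \<partial>M)" for k
      proof -
        have "(\<integral>y. U t y \<bullet> ?Y k y \<partial>N) = (\<Sum>s\<in>F k. c k s * (\<integral>y. U t y \<bullet> U s y \<partial>N))"
          by (rule integral_inner_lincomb[OF U F(2) U[OF t]])
        also have "\<dots> = (\<Sum>s\<in>F k. c k s * (\<integral>x. V t x \<bullet> V s x \<partial>M))"
          by (intro sum.cong arg_cong2[where f = "(*)"] refl gram[symmetric] t) (use F(2) in auto)
        also have "\<dots> = (\<integral>x. V t x \<bullet> ?X k x \<partial>M)"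
          by (rule integral_inner_lincomb[OF V F(2) V[OF t], symmetric])
        finally show ?thesis .
      qed
      show ?thesis
        using tendsto_integral_inner[OF Y g U[OF t] gl] tendsto_integral_inner[OF X sf V[OF t] Fl]
        unfolding eq by (rule LIMSEQ_unique)
    qed
  qed
qed

section \<open>The generating function of the modified Bessel functions\<close>

definition bessel_term :: "real \<Rightarrow> int \<Rightarrow> nat \<Rightarrow> real" where
  "bessel_term x n m = rGamma (of_int (int m + n + 1)) / fact m * (x / 2) powi (2 * int m + n)"

lemma bessel_term_eq:
  assumes "int m + n = int p"
  shows "bessel_term x n m = (x / 2) ^ p / fact p * ((x / 2) ^ m / fact m)"
proof -
  have "rGamma (of_int (int m + n + 1) :: real) = inverse (fact p)"
  proof -
    have "(of_int (int m + n + 1) :: real) = 1 + of_nat p" unfolding assms by simp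
    then show ?thesis by (simp only: rGamma_inverse_Gamma Gamma_fact)
  qed
  moreover have "2 * int m + n = int (p + m)" using assms by simp
  then have "(x / 2) powi (2 * int m + n) = (x / 2) ^ (p + m)"
    by (simp only: power_int_of_nat)
  ultimately show ?thesis by (simp add: bessel_term_def power_add field_simps)
qed

lemma bessel_term_eq_0:
  assumes "int m + n < 0"
  shows "bessel_term x n m = 0"
proof -
  have "(of_int (int m + n + 1) :: real) \<in> \<int>\<^sub>\<le>\<^sub>0"
    using assms by (intro nonpos_Ints_of_int) simp
  then show ?thesis by (simp add: bessel_term_def rGamma_nonpos_Int del: of_int_add)
qed

text \<open>
  Multiply the series of \<open>exp (x e\<^bsup>i\<theta>\<^esup> / 2)\<close> and \<open>exp (x e\<^bsup>-i\<theta>\<^esup> / 2)\<close>. The product of the terms of orders \<open>p\<close>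
  and \<open>q\<close> has the frequency \<open>p - q\<close>, and it is the term of index \<open>q\<close> of the Bessel series of order
  \<open>p - q\<close>. The pairs \<open>(n, m)\<close> with \<open>m + n < 0\<close> do not arise in this way, and their terms vanish.
\<close>

lemma bessel_term_has_sum:
  "((\<lambda>(n, m). of_real (bessel_term x n m) * cis (of_int n * \<theta>)) has_sum of_real (exp (x * cos \<theta>)))
    (UNIV \<times> UNIV)"
proof -
  define y where "y = x / 2"
  let ?e = "\<lambda>z::complex. \<lambda>k::nat. z ^ k /\<^sub>R fact k"
  let ?z = "of_real y * cis \<theta>" and ?w = "of_real y * cis (- \<theta>)"
  have abs: "Infinite_Set_Sum.abs_summable_on (?e z) UNIV" for z
    using summable_norm_exp[of z] by (simp add: abs_summable_on_nat_iff')
  have sum: "infsetsum (?e z) UNIV = exp z" for z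
    unfolding infsetsum_nat'[OF abs] by (rule sums_unique[OF exp_converges, symmetric])
  let ?P = "\<lambda>(p, q). ?e ?z p * ?e ?w q"
  have absP: "Infinite_Set_Sum.abs_summable_on ?P (UNIV \<times> UNIV)"
    by (rule abs_summable_on_product) (auto intro: abs)
  have "infsetsum ?P (UNIV \<times> UNIV) = exp ?z * exp ?w"
    by (subst infsetsum_product) (auto simp: abs sum)
  also have "\<dots> = of_real (exp (x * cos \<theta>))"
  proof -
    have "?z + ?w = of_real (x * cos \<theta>)" by (simp add: complex_eq_iff y_def)
    then show ?thesis by (simp only: exp_add[symmetric] exp_of_real)
  qed
  finally have P: "(?P has_sum of_real (exp (x * cos \<theta>))) (UNIV \<times> UNIV)"
    using has_sum_infsum[OF abs_summable_summable[OF iffD2[OF abs_summable_equivalent absP]]]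
    by (simp only: infsetsum_infsum[OF absP])
  let ?G = "\<lambda>(n, m). of_real (bessel_term x n m) * cis (of_int n * \<theta>)"
  let ?h = "\<lambda>(p, q). (int p - int q, q)"
  have inj: "inj_on ?h (UNIV \<times> UNIV)" by (auto simp: inj_on_def)
  have "?G \<circ> ?h = ?P"
  proof (rule ext, clarify)
    fix p q :: nat
    have "cis (of_int (int p - int q) * \<theta>) = cis \<theta> ^ p * cis (- \<theta>) ^ q"
      by (simp add: Complex.DeMoivre cis_mult algebra_simps)
    moreover have "bessel_term x (int p - int q) q = y ^ p / fact p * (y ^ q / fact q)"
      unfolding y_def by (rule bessel_term_eq) simp
    ultimately show "(?G \<circ> ?h) (p, q) = ?e ?z p * ?e ?w q"
      by (simp add: power_mult_distrib scaleR_conv_of_real divide_inverse)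
  qed
  with P have Gh: "((?G \<circ> ?h) has_sum of_real (exp (x * cos \<theta>))) (UNIV \<times> UNIV)" by simp
  have G: "(?G has_sum of_real (exp (x * cos \<theta>))) (?h ` (UNIV \<times> UNIV))"
    by (rule iffD2[OF has_sum_reindex[OF inj] Gh])
  have G0: "?G nm = 0" if "nm \<notin> ?h ` (UNIV \<times> UNIV)" for nm
  proof -
    obtain n m where nm: "nm = (n, m)" by fastforce
    have "int m + n < 0"
    proof (rule ccontr)
      assume "\<not> int m + n < 0"
      then have "nm = ?h (nat (int m + n), m)" by (simp add: nm)
      with that show False by blast
    qed
    then show ?thesis by (simp add: nm bessel_term_eq_0)
  qed
  have "(?G has_sum of_real (exp (x * cos \<theta>))) (?h ` (UNIV \<times> UNIV))
      \<longleftrightarrow> (?G has_sum of_real (exp (x * cos \<theta>))) (UNIV \<times> UNIV)"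
    by (rule has_sum_cong_neutral) (simp_all add: G0)
  then show ?thesis using G by (rule iffD1)
qed

lemma bessel_I_has_sum: "(bessel_term x n has_sum bessel_I n x) UNIV"
proof -
  have "(\<lambda>(n, m). of_real (bessel_term x n m) :: complex) summable_on UNIV \<times> UNIV"
    using has_sum_imp_summable[OF bessel_term_has_sum[of x 0]] by simp
  then have "(\<lambda>m. of_real (bessel_term x n m) :: complex) summable_on UNIV"
    by (rule summable_on_SigmaD1) simp
  then obtain S where "((\<lambda>m. of_real (bessel_term x n m) :: complex) has_sum S) UNIV"
    unfolding summable_on_def by (rule exE)
  from has_sum_Re[OF this] have S: "(bessel_term x n has_sum Re S) UNIV" by simp
  from sums_unique[OF has_sum_imp_sums[OF this]] have "Re S = bessel_I n x"
    by (simp only: bessel_I_def bessel_term_def[abs_def])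
  with S show ?thesis by simp
qed

lemma bessel_I_generating_function:
  "((\<lambda>n. of_real (bessel_I n x) * cis (of_int n * \<theta>)) has_sum of_real (exp (x * cos \<theta>))) UNIV"
proof (rule has_sum_Sigma'[OF bessel_term_has_sum])
  fix n :: int
  show "((\<lambda>m. case (n, m) of (n, m) \<Rightarrow> of_real (bessel_term x n m) * cis (of_int n * \<theta>)) has_sum
      of_real (bessel_I n x) * cis (of_int n * \<theta>)) UNIV"
    unfolding prod.case
    by (intro has_sum_cmult_left has_sum_of_real bessel_I_has_sum)
qed

lemma bessel_I_pos:
  assumes "x > 0"
  shows "bessel_I n x > 0"
proof (rule ccontr)
  assume le: "\<not> bessel_I n x > 0"
  have nonneg: "bessel_term x n m \<ge> 0" for m
  proof (cases "int m + n < 0")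
    case False
    then have "int m + n = int (nat (int m + n))" by simp
    from bessel_term_eq[OF this] show ?thesis using assms by simp
  qed (simp add: bessel_term_eq_0)
  \<comment> \<open>The term of index \<open>\<bar>n\<bar>\<close> is positive because \<open>\<bar>n\<bar> + n\<close> is nonnegative.\<close>
  have "bessel_term x n (nat \<bar>n\<bar>) = 0"
    by (rule nonneg_has_sum_le_0D[OF bessel_I_has_sum]) (use le nonneg in simp_all)
  moreover have "int (nat \<bar>n\<bar>) + n = int (nat (\<bar>n\<bar> + n))" by simp
  from bessel_term_eq[OF this, of x] have "bessel_term x n (nat \<bar>n\<bar>) > 0"
    using assms by simp
  ultimately show False by simp
qed

text \<open>
  Exchanging \<open>p\<close> and \<open>q\<close> in the product of the two exponential series reverses the sign of the order.
\<close>

lemma bessel_I_minus: "bessel_I (- n) x = bessel_I n x"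
proof -
  have restrict: "(bessel_term x n has_sum bessel_I n x) {m. int m + n \<ge> 0}" for n
  proof -
    have "(bessel_term x n has_sum bessel_I n x) {m. int m + n \<ge> 0}
        \<longleftrightarrow> (bessel_term x n has_sum bessel_I n x) UNIV"
      by (rule has_sum_cong_neutral) (simp_all add: bessel_term_eq_0)
    then show ?thesis using bessel_I_has_sum by simp
  qed
  let ?S = "\<lambda>n. {m. int m + n \<ge> 0}" and ?j = "\<lambda>m. nat (int m + n)"
  have "bij_betw ?j (?S n) (?S (- n))"
    by (rule bij_betwI[where g = "\<lambda>m. nat (int m - n)"]) auto
  from has_sum_reindex_bij_betw[OF this, of "bessel_term x (- n)" "bessel_I (- n) x"] restrict[of "- n"]
  have reindexed: "((\<lambda>m. bessel_term x (- n) (?j m)) has_sum bessel_I (- n) x) (?S n)" by (rule iffD2)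
  have eq: "bessel_term x (- n) (?j m) = bessel_term x n m" if "m \<in> ?S n" for m
  proof -
    have "int m + n = int (?j m)" "int (?j m) + - n = int m" using that by simp_all
    from bessel_term_eq[OF this(1)] bessel_term_eq[OF this(2)] show ?thesis
      by (simp only: mult.commute)
  qed
  have "(bessel_term x n has_sum bessel_I (- n) x) (?S n)"
    by (rule iffD1[OF has_sum_cong[OF eq] reindexed])
  then show ?thesis using restrict[of n] by (rule has_sum_unique)
qed

section \<open>The spectral measure of the periodic kernel\<close>

lemma spectral_weight_pos:
  assumes "a > 0"
  shows "spectral_weight a n > 0"
  unfolding spectral_weight_def by (intro mult_pos_pos bessel_I_pos) (use assms in simp_all)

lemma spectral_weight_minus: "spectral_weight a (- n) = spectral_weight a n"
  by (simp only: spectral_weight_def bessel_I_minus)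

text \<open>
  The half-angle formula \<open>2 sin\<^sup>2(\<pi>u) = 1 - cos (2\<pi>u)\<close> turns the kernel into the generating function.
\<close>

lemma spectral_weight_has_sum_kernel:
  "((\<lambda>n. of_real (spectral_weight a n) * cis (of_int n * (2 * pi * u))) has_sum
     complex_of_real (exp (- 4 * a\<^sup>2 * (sin (pi * u))\<^sup>2))) UNIV"
proof -
  let ?c = "complex_of_real (exp (- 2 * a\<^sup>2))"
  have "((\<lambda>n. ?c * (of_real (bessel_I n (2 * a\<^sup>2)) * cis (of_int n * (2 * pi * u)))) has_sum
      ?c * of_real (exp (2 * a\<^sup>2 * cos (2 * pi * u)))) UNIV"
    by (rule has_sum_cmult_right[OF bessel_I_generating_function])
  moreover have "?c * of_real (exp (2 * a\<^sup>2 * cos (2 * pi * u)))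
      = of_real (exp (- 4 * a\<^sup>2 * (sin (pi * u))\<^sup>2))"
  proof -
    have c: "cos (2 * pi * u) = 1 - 2 * (sin (pi * u))\<^sup>2"
      using cos_double_sin[of "pi * u"] by (simp add: mult.assoc)
    have "exp (- 2 * a\<^sup>2) * exp (2 * a\<^sup>2 * cos (2 * pi * u)) = exp (- 4 * a\<^sup>2 * (sin (pi * u))\<^sup>2)"
      unfolding c exp_add[symmetric] by (simp add: right_diff_distrib)
    then show ?thesis by (simp only: of_real_mult[symmetric])
  qed
  ultimately show ?thesis by (simp only: spectral_weight_def of_real_mult mult.assoc)
qed

lemma spectral_weight_has_sum_1: "(spectral_weight a has_sum 1) UNIV"
proof -
  have "((\<lambda>n. complex_of_real (spectral_weight a n)) has_sum of_real 1) UNIV"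
    using spectral_weight_has_sum_kernel[of a 0] by simp
  then show ?thesis by (simp only: has_sum_of_real_iff)
qed

definition spectral_measure :: "real \<Rightarrow> int measure" where
  "spectral_measure a = density (count_space UNIV) (\<lambda>n. ennreal (spectral_weight a n))"

lemma space_spectral_measure [simp]: "space (spectral_measure a) = UNIV"
  by (simp add: spectral_measure_def)

lemma measurable_spectral_measure [simp]:
  "f \<in> borel_measurable (spectral_measure a)"
  by (simp add: spectral_measure_def)

lemma integrable_spectral_measure_iff:
  fixes f :: "int \<Rightarrow> 'b::{banach,second_countable_topology}"
  assumes "a > 0"
  shows "integrable (spectral_measure a) f
    \<longleftrightarrow> (\<lambda>n. norm (spectral_weight a n *\<^sub>R f n)) summable_on UNIV"
proof -
  have "integrable (spectral_measure a) f
      \<longleftrightarrow> integrable (count_space UNIV) (\<lambda>n. spectral_weight a n *\<^sub>R f n)"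
    unfolding spectral_measure_def
    by (rule integrable_density) (simp_all add: less_imp_le[OF spectral_weight_pos[OF assms]])
  then show ?thesis
    by (simp only: abs_summable_equivalent abs_summable_on_def)
qed

lemma integral_spectral_measure_has_sum:
  fixes f :: "int \<Rightarrow> 'b::{banach,second_countable_topology}"
  assumes a: "a > 0" and f: "integrable (spectral_measure a) f"
  shows "((\<lambda>n. spectral_weight a n *\<^sub>R f n) has_sum (\<integral>n. f n \<partial>spectral_measure a)) UNIV"
proof -
  have abs: "(\<lambda>n. norm (spectral_weight a n *\<^sub>R f n)) summable_on UNIV"
    using f by (simp only: integrable_spectral_measure_iff[OF a])
  have "(\<integral>n. f n \<partial>spectral_measure a) = infsetsum (\<lambda>n. spectral_weight a n *\<^sub>R f n) UNIV"
    unfolding spectral_measure_def infsetsum_def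
    by (rule integral_density) (simp_all add: less_imp_le[OF spectral_weight_pos[OF a]])
  also have "\<dots> = infsum (\<lambda>n. spectral_weight a n *\<^sub>R f n) UNIV"
    by (rule infsetsum_infsum[OF iffD1[OF abs_summable_equivalent abs]])
  finally show ?thesis
    by (simp only: has_sum_infsum[OF abs_summable_summable[OF abs]])
qed

text \<open>
  The total mass is \<open>G\<^sub>a(t, t) = 1\<close>.
\<close>

lemma finite_measure_spectral_measure:
  assumes "a > 0"
  shows "finite_measure (spectral_measure a)"
proof
  have "integrable (spectral_measure a) (\<lambda>n. 1 :: real)"
    unfolding integrable_spectral_measure_iff[OF assms]
    using has_sum_imp_summable[OF spectral_weight_has_sum_1[of a]]
    by (simp add: abs_of_pos[OF spectral_weight_pos[OF assms]])
  then show "emeasure (spectral_measure a) (space (spectral_measure a)) \<noteq> \<infinity>"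
    by (simp add: integrable_iff_bounded)
qed

lemma square_integrable_spectral_measure_iff:
  fixes b :: "int \<Rightarrow> complex"
  assumes "a > 0"
  shows "square_integrable (spectral_measure a) b
    \<longleftrightarrow> (\<lambda>n. (cmod (b n))\<^sup>2 * spectral_weight a n) summable_on UNIV"
  by (simp add: square_integrable_def integrable_spectral_measure_iff[OF assms] abs_mult
      abs_of_pos[OF spectral_weight_pos[OF assms]] mult.commute)

lemma square_integrable_spectral_measure_has_sum:
  fixes b :: "int \<Rightarrow> complex"
  assumes "a > 0" and "square_integrable (spectral_measure a) b"
  shows "((\<lambda>n. (cmod (b n))\<^sup>2 * spectral_weight a n) has_sum
    (\<integral>n. (cmod (b n))\<^sup>2 \<partial>spectral_measure a)) UNIV"
  using integral_spectral_measure_has_sum[OF assms(1) integrable_norm_squared[OF assms(2)]]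
  by (simp add: mult.commute)

lemma bounded_square_integrable_spectral_measure:
  fixes b :: "int \<Rightarrow> complex"
  assumes a: "a > 0" and b: "\<And>n. cmod (b n) \<le> B"
  shows "square_integrable (spectral_measure a) b"
proof -
  interpret finite_measure "spectral_measure a" by (rule finite_measure_spectral_measure[OF a])
  have "integrable (spectral_measure a) (\<lambda>n. (cmod (b n))\<^sup>2)"
    by (rule integrable_const_bound[where B = "B\<^sup>2"]) (auto intro!: AE_I2 power_mono b)
  then show ?thesis by (simp add: square_integrable_def)
qed

section \<open>Fourier characters as a model of the process\<close>

text \<open>
  The index \<open>t\<close> comes first so that the characters form a family of functions on the integers indexed
  by \<open>t\<close>, as the process is a family of random variables indexed by \<open>t\<close>.
\<close>

definition fourier_character :: "real \<Rightarrow> int \<Rightarrow> complex" where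
  "fourier_character t n = cis (of_int n * (2 * pi * t))"

lemma cmod_fourier_character [simp]: "cmod (fourier_character t n) = 1"
  by (simp add: fourier_character_def)

lemma square_integrable_fourier_character:
  "a > 0 \<Longrightarrow> square_integrable (spectral_measure a) (fourier_character t)"
  by (rule bounded_square_integrable_spectral_measure[where B = 1]) simp_all

lemma fourier_character_minus: "fourier_character t (- n) = cnj (fourier_character t n)"
  by (simp add: fourier_character_def cis_cnj)

lemma fourier_character_mult:
  "cnj (fourier_character t k) * fourier_character t n = fourier_character t (n - k)"
  by (simp add: fourier_character_def cis_cnj cis_mult left_diff_distrib)

lemma fourier_character_exp:
  "exp (- (\<i> * of_real (t * 2 * pi * of_int n))) = cnj (fourier_character t n)"
  "exp (\<i> * of_real (t * 2 * pi * of_int n)) = fourier_character t n"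
proof -
  have arg: "t * 2 * pi * of_int n = of_int n * (2 * pi * t)" by (simp only: mult_ac)
  show "exp (\<i> * of_real (t * 2 * pi * of_int n)) = fourier_character t n"
    unfolding fourier_character_def arg by (rule cis_conv_exp[symmetric])
  show "exp (- (\<i> * of_real (t * 2 * pi * of_int n))) = cnj (fourier_character t n)"
    unfolding fourier_character_def arg cis_cnj by (simp add: cis_conv_exp)
qed

text \<open>
  The spectral measure is built so that its Fourier transform is the kernel.
\<close>

lemma fourier_character_gram:
  assumes a: "a > 0"
  shows "(\<integral>n. fourier_character s n \<bullet> fourier_character t n \<partial>spectral_measure a) = periodic_kernel a s t"
proof -
  note sq = square_integrable_fourier_character[OF a]
  have "((\<lambda>n. spectral_weight a n *\<^sub>R (fourier_character s n \<bullet> fourier_character t n)) has_sum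
      (\<integral>n. fourier_character s n \<bullet> fourier_character t n \<partial>spectral_measure a)) UNIV"
    by (rule integral_spectral_measure_has_sum[OF a integrable_inner[OF sq sq]])
  moreover have "spectral_weight a n *\<^sub>R (fourier_character s n \<bullet> fourier_character t n)
      = Re (of_real (spectral_weight a n) * cis (of_int n * (2 * pi * (s - t))))" for n
    by (simp add: fourier_character_def inner_complex_def cos_diff right_diff_distrib)
  moreover have "((\<lambda>n. Re (of_real (spectral_weight a n) * cis (of_int n * (2 * pi * (s - t))))) has_sum
      Re (of_real (exp (- 4 * a\<^sup>2 * (sin (pi * (s - t)))\<^sup>2)))) UNIV"
    by (rule has_sum_Re[OF spectral_weight_has_sum_kernel])
  ultimately have "(\<integral>n. fourier_character s n \<bullet> fourier_character t n \<partial>spectral_measure a)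
      = Re (of_real (exp (- 4 * a\<^sup>2 * (sin (pi * (s - t)))\<^sup>2)))"
    by (simp only:) (rule has_sum_unique)
  then show ?thesis by (simp add: periodic_kernel_def right_diff_distrib)
qed

definition hermitian :: "(int \<Rightarrow> complex) \<Rightarrow> bool" where
  "hermitian b \<longleftrightarrow> (\<forall>n. b (- n) = cnj (b n))"

lemma has_sum_uminus_int: "((\<lambda>n::int. f (- n)) has_sum S) UNIV \<longleftrightarrow> (f has_sum S) UNIV"
  by (rule has_sum_reindex_bij_betw) (rule bij_uminus)

lemma bessel_expansion_square_integrable:
  assumes "a > 0" and "bessel_expansion a b h"
  shows "square_integrable (spectral_measure a) b"
  using assms(2) unfolding square_integrable_spectral_measure_iff[OF assms(1)] bessel_expansion_def
  by (rule conjunct1)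

lemma bessel_expansion_cong:
  assumes g: "bessel_expansion a b g" and eq: "\<And>t. t \<in> {0..1} \<Longrightarrow> g t = h t"
  shows "bessel_expansion a b h"
  using g unfolding bessel_expansion_def by (simp add: eq)

lemma bessel_expansion_eqD:
  assumes g: "bessel_expansion a b g" and h: "bessel_expansion a b h" and t: "t \<in> {0..1}"
  shows "g t = h t"
proof (rule has_sum_unique)
  let ?f = "\<lambda>n. exp (- (\<i> * of_real (t * 2 * pi * of_int n))) * b n * of_real (spectral_weight a n)"
  show "(?f has_sum g t) UNIV"
    using g t unfolding bessel_expansion_def by (elim conjE) (rule bspec)
  show "(?f has_sum h t) UNIV"
    using h t unfolding bessel_expansion_def by (elim conjE) (rule bspec)
qed

text \<open>
  For a Hermitian sequence the terms of index \<open>n\<close> and \<open>-n\<close> of the series are conjugate, so the series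
  is real and equals its real part, which is the inner product with the character.
\<close>

lemma bessel_expansion_hermitian:
  assumes a: "a > 0" and b: "square_integrable (spectral_measure a) b" and herm: "hermitian b"
  shows "bessel_expansion a b
    (\<lambda>t. of_real (\<integral>n. fourier_character t n \<bullet> b n \<partial>spectral_measure a))"
  unfolding bessel_expansion_def
proof (intro conjI ballI)
  show "(\<lambda>n. (cmod (b n))\<^sup>2 * spectral_weight a n) summable_on UNIV"
    using b by (simp only: square_integrable_spectral_measure_iff[OF a])
  fix t :: real
  interpret finite_measure "spectral_measure a" by (rule finite_measure_spectral_measure[OF a])
  let ?f = "\<lambda>n. cnj (fourier_character t n) * b n"
  let ?S = "\<integral>n. ?f n \<partial>spectral_measure a"
  have int: "integrable (spectral_measure a) ?f"
  proof (rule integrable_square_integrable)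
    show "square_integrable (spectral_measure a) ?f"
      using b by (simp add: square_integrable_def norm_mult)
  qed
  have sum: "((\<lambda>n. spectral_weight a n *\<^sub>R ?f n) has_sum ?S) UNIV"
    by (rule integral_spectral_measure_has_sum[OF a int])
  have "cnj (spectral_weight a n *\<^sub>R ?f n) = spectral_weight a (- n) *\<^sub>R ?f (- n)" for n
    using herm by (simp add: hermitian_def spectral_weight_minus fourier_character_def cis_cnj)
  then have "((\<lambda>n. spectral_weight a (- n) *\<^sub>R ?f (- n)) has_sum cnj ?S) UNIV"
    using iffD2[OF has_sum_cnj_iff sum] by (simp only:)
  from iffD1[OF has_sum_uminus_int this] have "?S = cnj ?S"
    by (rule has_sum_unique[OF sum])
  then have real: "?S = of_real (Re ?S)" by (simp add: complex_eq_iff)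
  have "((\<lambda>n. Re (spectral_weight a n *\<^sub>R ?f n)) has_sum Re ?S) UNIV"
    by (rule has_sum_Re[OF sum])
  moreover have "Re (spectral_weight a n *\<^sub>R ?f n)
      = spectral_weight a n *\<^sub>R (fourier_character t n \<bullet> b n)" for n
    by (simp add: inner_complex_def)
  ultimately have "((\<lambda>n. spectral_weight a n *\<^sub>R (fourier_character t n \<bullet> b n)) has_sum Re ?S) UNIV"
    by (simp only:)
  from has_sum_unique[OF this integral_spectral_measure_has_sum[OF a
        integrable_inner[OF square_integrable_fourier_character[OF a] b]]]
  have "Re ?S = (\<integral>n. fourier_character t n \<bullet> b n \<partial>spectral_measure a)" .
  with real have S: "?S = of_real (\<integral>n. fourier_character t n \<bullet> b n \<partial>spectral_measure a)" by simp
  have "exp (- (\<i> * of_real (t * 2 * pi * of_int n))) * b n * of_real (spectral_weight a n)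
      = spectral_weight a n *\<^sub>R ?f n" for n
    unfolding fourier_character_exp scaleR_conv_of_real by (rule mult.commute)
  with sum show "((\<lambda>n. exp (- (\<i> * of_real (t * 2 * pi * of_int n))) * b n *
      of_real (spectral_weight a n)) has_sum
      of_real (\<integral>n. fourier_character t n \<bullet> b n \<partial>spectral_measure a)) UNIV"
    by (simp only: S)
qed

section \<open>Hermitian sequences as the closed span of the characters\<close>

lemma sum_roots_of_unity:
  assumes N: "N > 0"
  shows "(\<Sum>j<N. cis (of_int m * (2 * pi * (real j / real N)))) = (if int N dvd m then of_nat N else 0)"
proof -
  define z where "z = cis (of_int m * (2 * pi / real N))"
  have power: "cis (of_int m * (2 * pi * (real j / real N))) = z ^ j" for j
    unfolding z_def Complex.DeMoivre by (simp add: mult_ac)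
  show ?thesis
  proof (cases "int N dvd m")
    case True
    then obtain l where "m = int N * l" by blast
    then have "of_int m * (2 * pi / real N) = of_int l * (2 * pi)"
      using N by simp
    then have "z = 1"
      using cis_multiple_2pi[OF Ints_of_int, of l] by (simp add: z_def mult.commute)
    with True show ?thesis unfolding power by simp
  next
    case False
    have "z \<noteq> 1"
    proof
      assume "z = 1"
      then have "cos (of_int m * (2 * pi / real N)) = 1" by (simp add: z_def complex_eq_iff)
      then obtain l :: int where "of_int m * (2 * pi / real N) = of_int l * 2 * pi"
        using cos_one_2pi_int by blast
      then have "of_int m = real N * of_int l" using N by (simp add: field_simps)
      then have "of_int m = (of_int (int N * l) :: real)" by simp
      then have "m = int N * l" by (simp only: of_int_eq_iff)
      with False show False by simp
    qed
    moreover have "z ^ N = 1"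
    proof -
      have "z ^ N = cis (of_int m * (2 * pi))"
        unfolding z_def Complex.DeMoivre using N by simp
      then show ?thesis
        using cis_multiple_2pi[OF Ints_of_int, of m] by (simp add: mult.commute)
    qed
    ultimately show ?thesis using False unfolding power by (simp add: geometric_sum)
  qed
qed

lemma hermitian_sum_real:
  assumes "hermitian f"
  shows "of_real (Re (\<Sum>k\<in>{- int K..int K}. f k)) = (\<Sum>k\<in>{- int K..int K}. f k)"
proof -
  have "cnj (\<Sum>k\<in>{- int K..int K}. f k) = (\<Sum>k\<in>{- int K..int K}. f (- k))"
    using assms by (simp add: hermitian_def)
  also have "\<dots> = (\<Sum>k\<in>{- int K..int K}. f k)"
    by (rule sum.reindex_bij_witness[where i = uminus and j = uminus]) auto
  finally show ?thesis by (intro of_real_Re) (simp only: Reals_cnj_iff)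
qed

text \<open>
  The coefficient at the node \<open>t = j / N\<close> is \<open>1 / N\<close> times the value at \<open>t\<close> of the trigonometric polynomial
  with coefficients \<open>b\<close>. It is real because \<open>b\<close> is Hermitian. By orthogonality of the roots of unity,
  the sum over the nodes retains exactly the indices that are congruent to \<open>n\<close> modulo \<open>N\<close>.
\<close>

lemma lincomb_periodisation:
  assumes N: "N > 0" and herm: "hermitian b"
  shows "lincomb ((\<lambda>j. real j / real N) ` {..<N})
      (\<lambda>t. Re (\<Sum>k\<in>{- int K..int K}. b k * cnj (fourier_character t k)) / real N) fourier_character n
    = (\<Sum>k\<in>{- int K..int K}. if int N dvd n - k then b k else 0)"
proof -
  let ?K = "{- int K..int K}"
  let ?c = "\<lambda>t. Re (\<Sum>k\<in>?K. b k * cnj (fourier_character t k)) / real N"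
  have inj: "inj_on (\<lambda>j. real j / real N) {..<N}"
    using N by (simp add: inj_on_def)
  have c: "?c t *\<^sub>R z = (\<Sum>k\<in>?K. b k * cnj (fourier_character t k)) / of_nat N * z" for t and z :: complex
  proof -
    have "hermitian (\<lambda>k. b k * cnj (fourier_character t k))"
      using herm by (simp add: hermitian_def fourier_character_minus)
    from hermitian_sum_real[OF this, of K] show ?thesis by (simp add: scaleR_conv_of_real)
  qed
  have char: "cnj (fourier_character t k) * fourier_character t n = cis (of_int (n - k) * (2 * pi * t))" for t k
    unfolding fourier_character_mult by (rule fourier_character_def)
  have "lincomb ((\<lambda>j. real j / real N) ` {..<N}) ?c fourier_character n
      = (\<Sum>j<N. (\<Sum>k\<in>?K. b k * cnj (fourier_character (real j / real N) k)) / of_nat N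
          * fourier_character (real j / real N) n)"
    unfolding lincomb_def c by (simp add: sum.reindex[OF inj])
  also have "\<dots> = (\<Sum>j<N. \<Sum>k\<in>?K. b k / of_nat N * cis (of_int (n - k) * (2 * pi * (real j / real N))))"
    by (simp only: char[symmetric] sum_distrib_right sum_divide_distrib) (simp add: mult_ac)
  also have "\<dots> = (\<Sum>k\<in>?K. \<Sum>j<N. b k / of_nat N * cis (of_int (n - k) * (2 * pi * (real j / real N))))"
    by (rule sum.swap)
  also have "\<dots> = (\<Sum>k\<in>?K. if int N dvd n - k then b k else 0)"
    unfolding sum_distrib_left[symmetric] sum_roots_of_unity[OF N]
    by (rule sum.cong[OF refl]) (use N in simp)
  finally show ?thesis .
qed

text \<open>
  Once the period exceeds \<open>\<bar>n\<bar> + K\<close>, the periodisation agrees with \<open>b\<close> at \<open>n\<close>. The periodisations are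
  uniformly bounded, so by dominated convergence they converge in mean square too.
\<close>

lemma finite_support_in_closed_span:
  assumes a: "a > 0" and herm: "hermitian b" and supp: "\<And>n. \<bar>n\<bar> > int K \<Longrightarrow> b n = 0"
  shows "b \<in> closed_span (spectral_measure a) {0..1} fourier_character"
proof -
  interpret finite_measure "spectral_measure a" by (rule finite_measure_spectral_measure[OF a])
  let ?K = "{- int K..int K}"
  \<comment> \<open>The period is \<open>Suc i\<close> so that it is positive for every \<open>i\<close>.\<close>
  let ?F = "\<lambda>i. (\<lambda>j. real j / real (Suc i)) ` {..<Suc i}"
  let ?c = "\<lambda>i t. Re (\<Sum>k\<in>?K. b k * cnj (fourier_character t k)) / real (Suc i)"
  let ?u = "\<lambda>i n. lincomb (?F i) (?c i) fourier_character n"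
  define B where "B = (\<Sum>k\<in>?K. cmod (b k))"
  have u: "?u i n = (\<Sum>k\<in>?K. if int (Suc i) dvd n - k then b k else 0)" for i n
    by (rule lincomb_periodisation) (use herm in simp_all)
  have u_le: "cmod (?u i n) \<le> B" for i n
    unfolding u B_def by (rule sum_norm_le) simp
  have b_le: "cmod (b n) \<le> B" for n
  proof (cases "n \<in> ?K")
    case True
    then show ?thesis unfolding B_def by (intro member_le_sum) simp_all
  next
    case False
    then have "b n = 0" by (intro supp) auto
    then show ?thesis by (simp add: B_def sum_nonneg)
  qed
  have eventually_eq: "?u i n = b n" if i: "i \<ge> nat \<bar>n\<bar> + K" for i n
  proof -
    have "int (Suc i) dvd n - k \<longleftrightarrow> k = n" if "k \<in> ?K" for k
    proof
      assume "int (Suc i) dvd n - k"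
      moreover have "\<bar>n - k\<bar> < int (Suc i)" using i that by auto
      ultimately show "k = n" using zdvd_not_zless[of "\<bar>n - k\<bar>" "int (Suc i)"] by auto
    qed simp
    then have "?u i n = (\<Sum>k\<in>?K. if k = n then b k else 0)"
      unfolding u by (intro sum.cong refl) simp
    also have "\<dots> = b n" using supp[of n] by auto
    finally show ?thesis .
  qed
  have "(\<lambda>i. \<integral>n. (cmod (?u i n - b n))\<^sup>2 \<partial>spectral_measure a) \<longlonglongrightarrow> (\<integral>n. 0 \<partial>spectral_measure a)"
  proof (rule integral_dominated_convergence[where w = "\<lambda>n. (2 * B)\<^sup>2"])
    show "AE n in spectral_measure a. (\<lambda>i. (cmod (?u i n - b n))\<^sup>2) \<longlonglongrightarrow> 0"
    proof (rule AE_I2)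
      fix n
      have "\<forall>\<^sub>F i in sequentially. (cmod (?u i n - b n))\<^sup>2 = 0"
        by (rule eventually_sequentiallyI[of "nat \<bar>n\<bar> + K"]) (simp only: eventually_eq, simp)
      then show "(\<lambda>i. (cmod (?u i n - b n))\<^sup>2) \<longlonglongrightarrow> 0"
        by (rule tendsto_eventually)
    qed
    show "AE n in spectral_measure a. norm ((cmod (?u i n - b n))\<^sup>2) \<le> (2 * B)\<^sup>2" for i
    proof (rule AE_I2)
      fix n
      have "cmod (?u i n - b n) \<le> 2 * B"
        using norm_triangle_ineq4[of "?u i n" "b n"] u_le[of i n] b_le[of n] by linarith
      then show "norm ((cmod (?u i n - b n))\<^sup>2) \<le> (2 * B)\<^sup>2"
        unfolding real_norm_def abs_power2 by (rule power_mono) simp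
    qed
    show "integrable (spectral_measure a) (\<lambda>n. (2 * B)\<^sup>2)" by (rule integrable_const)
  qed (rule measurable_spectral_measure)+
  then have lim: "(\<lambda>i. \<integral>n. (cmod (?u i n - b n))\<^sup>2 \<partial>spectral_measure a) \<longlonglongrightarrow> 0"
    by (simp only: Bochner_Integration.integral_zero)
  have fin: "finite (?F i)" for i by simp
  have sub: "?F i \<subseteq> {0..1}" for i by auto
  show ?thesis
    by (rule closed_spanI[OF bounded_square_integrable_spectral_measure[OF a b_le] fin sub lim])
qed

text \<open>
  A square-integrable sequence is the limit of its truncations to symmetric intervals, and these
  truncations remain Hermitian.
\<close>

lemma hermitian_in_closed_span:
  assumes a: "a > 0" and b: "square_integrable (spectral_measure a) b" and herm: "hermitian b"
  shows "b \<in> closed_span (spectral_measure a) {0..1} fourier_character"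
proof -
  let ?b = "\<lambda>K n. if \<bar>n\<bar> \<le> int K then b n else 0"
  have span: "?b K \<in> closed_span (spectral_measure a) {0..1} fourier_character" for K
    by (rule finite_support_in_closed_span[OF a, where K = K]) (use herm in \<open>auto simp: hermitian_def\<close>)
  have "(\<lambda>K. \<integral>n. (cmod (?b K n - b n))\<^sup>2 \<partial>spectral_measure a) \<longlonglongrightarrow> (\<integral>n. 0 \<partial>spectral_measure a)"
  proof (rule integral_dominated_convergence[where w = "\<lambda>n. (cmod (b n))\<^sup>2"])
    show "AE n in spectral_measure a. (\<lambda>K. (cmod (?b K n - b n))\<^sup>2) \<longlonglongrightarrow> 0"
    proof (rule AE_I2)
      fix n
      have "\<forall>\<^sub>F K in sequentially. (cmod (?b K n - b n))\<^sup>2 = 0"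
        by (rule eventually_sequentiallyI[of "nat \<bar>n\<bar>"]) auto
      then show "(\<lambda>K. (cmod (?b K n - b n))\<^sup>2) \<longlonglongrightarrow> 0"
        by (rule tendsto_eventually)
    qed
    show "AE n in spectral_measure a. norm ((cmod (?b K n - b n))\<^sup>2) \<le> (cmod (b n))\<^sup>2" for K
      by (rule AE_I2) simp
    show "integrable (spectral_measure a) (\<lambda>n. (cmod (b n))\<^sup>2)"
      by (rule integrable_norm_squared[OF b])
  qed (rule measurable_spectral_measure)+
  then have lim: "(\<lambda>K. \<integral>n. (cmod (?b K n - b n))\<^sup>2 \<partial>spectral_measure a) \<longlonglongrightarrow> 0"
    by (simp only: Bochner_Integration.integral_zero)
  show ?thesis
    by (rule closed_span_closed[OF square_integrable_fourier_character[OF a] span b lim])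
qed

text \<open>
  Every point has positive weight, so convergence in mean square implies pointwise convergence, and
  pointwise limits of Hermitian sequences are Hermitian.
\<close>

lemma hermitian_of_closed_span:
  assumes a: "a > 0" and b: "b \<in> closed_span (spectral_measure a) T fourier_character"
  shows "hermitian b"
proof -
  obtain F c where Fc: "\<And>k::nat. finite (F k)" "\<And>k. F k \<subseteq> T"
    and lim: "(\<lambda>k. \<integral>n. (cmod (lincomb (F k) (c k) fourier_character n - b n))\<^sup>2 \<partial>spectral_measure a)
      \<longlonglongrightarrow> 0"
    by (rule closed_span_sequence[OF b]) (rule that)
  let ?u = "\<lambda>k. lincomb (F k) (c k) fourier_character"
  have sq: "square_integrable (spectral_measure a) (\<lambda>n. ?u k n - b n)" for k
  proof (rule square_integrable_diff)
    show "square_integrable (spectral_measure a) (?u k)"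
      by (rule square_integrable_lincomb[OF square_integrable_fourier_character[OF a] subset_UNIV])
    show "square_integrable (spectral_measure a) b" using b by (simp add: closed_span_def)
  qed
  have pointwise: "(\<lambda>k. ?u k n) \<longlonglongrightarrow> b n" for n
  proof -
    have le: "norm ((cmod (?u k n - b n))\<^sup>2)
        \<le> (\<integral>n. (cmod (?u k n - b n))\<^sup>2 \<partial>spectral_measure a) / spectral_weight a n" for k
    proof -
      have "(\<Sum>m\<in>{n}. (cmod (?u k m - b m))\<^sup>2 * spectral_weight a m)
          \<le> (\<integral>n. (cmod (?u k n - b n))\<^sup>2 \<partial>spectral_measure a)"
        by (rule finite_sum_le_has_sum[OF square_integrable_spectral_measure_has_sum[OF a sq]])
          (simp_all add: less_imp_le[OF spectral_weight_pos[OF a]])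
      then show ?thesis by (simp add: pos_le_divide_eq[OF spectral_weight_pos[OF a]])
    qed
    have "(\<lambda>k. (\<integral>n. (cmod (?u k n - b n))\<^sup>2 \<partial>spectral_measure a) / spectral_weight a n)
        \<longlonglongrightarrow> 0 / spectral_weight a n"
      by (rule tendsto_divide[OF lim tendsto_const])
        (rule spectral_weight_pos[OF a, THEN less_imp_neq, symmetric])
    then have "(\<lambda>k. (\<integral>n. (cmod (?u k n - b n))\<^sup>2 \<partial>spectral_measure a) / spectral_weight a n)
        \<longlonglongrightarrow> 0" by (simp only: div_0)
    then have "(\<lambda>k. (cmod (?u k n - b n))\<^sup>2) \<longlonglongrightarrow> 0"
      by (rule Lim_null_comparison[OF always_eventually, rotated]) (intro allI le)
    then have "(\<lambda>k. sqrt ((cmod (?u k n - b n))\<^sup>2)) \<longlonglongrightarrow> sqrt 0"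
      by (rule tendsto_real_sqrt)
    then have "(\<lambda>k. cmod (?u k n - b n)) \<longlonglongrightarrow> 0"
      by (simp only: real_sqrt_abs abs_norm_cancel real_sqrt_zero)
    then show ?thesis by (rule LIM_zero_cancel[OF tendsto_norm_zero_cancel])
  qed
  have "b (- n) = cnj (b n)" for n
  proof -
    have u: "?u k (- n) = cnj (?u k n)" for k
      by (simp add: lincomb_def fourier_character_minus)
    have "(\<lambda>k. ?u k (- n)) \<longlonglongrightarrow> cnj (b n)"
      unfolding u by (rule tendsto_cnj[OF pointwise])
    with pointwise show ?thesis by (rule LIMSEQ_unique)
  qed
  then show ?thesis by (simp add: hermitian_def)
qed

section \<open>Fourier coefficients of Bessel expansions\<close>

lemma integral_fourier_character:
  "has_bochner_integral lborel (\<lambda>t. indicator {0..1} t *\<^sub>R fourier_character t n) (if n = 0 then 1 else 0)"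
proof (cases "n = 0")
  case True
  have "has_bochner_integral lborel (\<lambda>t :: real. indicator {0..1} t *\<^sub>R (1 :: complex)) (of_real 1 - of_real 0)"
  proof (rule has_bochner_integral_FTC_Icc)
    fix t :: real
    show "(complex_of_real has_vector_derivative 1) (at t within {0..1})"
      by (rule has_vector_derivative_real_field[where f = "\<lambda>z. z"]) (rule DERIV_ident)
  qed simp_all
  with True show ?thesis by (simp add: fourier_character_def)
next
  case False
  define c where "c = \<i> * (of_int n * (2 * of_real pi))"
  have c: "c \<noteq> 0" using False by (simp add: c_def)
  have char: "fourier_character t n = exp (c * of_real t)" for t
    by (simp add: fourier_character_def c_def cis_conv_exp mult_ac)
  have "has_bochner_integral lborel (\<lambda>t. indicator {0..1} t *\<^sub>R fourier_character t n)
      (exp (c * of_real 1) / c - exp (c * of_real 0) / c)"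
    unfolding char
  proof (rule has_bochner_integral_FTC_Icc)
    fix t :: real
    have "((\<lambda>z. exp (c * z) / c) has_field_derivative exp (c * of_real t)) (at (of_real t))"
      using c by (auto intro!: derivative_eq_intros)
    then show "((\<lambda>t. exp (c * of_real t) / c) has_vector_derivative exp (c * of_real t)) (at t within {0..1})"
      by (rule has_vector_derivative_real_field)
  qed (auto intro!: continuous_intros)
  moreover have "exp (c * of_real 1) = 1"
    using char[of 1] cis_multiple_2pi[OF Ints_of_int, of n] by (simp add: fourier_character_def mult.commute)
  ultimately show ?thesis using False by simp
qed

text \<open>
  An absolutely convergent trigonometric series may be integrated term by term, and the characters
  are orthonormal on the unit interval. The integers are enumerated in order to apply the theorem on
  termwise integration of sequences.
\<close>

lemma fourier_coefficient:
  assumes g: "(\<lambda>n. cmod (g n)) summable_on UNIV"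
    and h: "\<And>t. t \<in> {0..1} \<Longrightarrow> ((\<lambda>n. cnj (fourier_character t n) * g n) has_sum h t) UNIV"
  shows "set_integrable lborel {0..1} (\<lambda>t. h t * fourier_character t m)"
    and "(LBINT t:{0..1}. h t * fourier_character t m) = g m"
proof -
  let ?f = "\<lambda>k t. g (int_decode k) * (indicator {0..1} t *\<^sub>R fourier_character t (m - int_decode k))"
  have f: "has_bochner_integral lborel (?f k) (g (int_decode k) * (if m - int_decode k = 0 then 1 else 0))" for k
    by (rule has_bochner_integral_mult_right[OF integral_fourier_character])
  have int: "integrable lborel (?f k)" for k
    using f[of k] by (rule integrable.intros)
  have norm: "norm (?f k t) = indicator {0..1} t * cmod (g (int_decode k))" for k t
    by (simp add: norm_mult indicator_def)
  have "(\<lambda>k. cmod (g (int_decode k))) summable_on UNIV"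
    using g by (simp only: summable_on_reindex_bij_betw[OF bij_int_decode, of "\<lambda>n. cmod (g n)"])
  then have summable: "summable (\<lambda>k. cmod (g (int_decode k)))"
    by (rule summable_on_imp_summable)
  have summable_f: "AE t in lborel. summable (\<lambda>k. norm (?f k t))"
    unfolding norm by (intro AE_I2 summable_mult summable)
  have "(\<integral>t. norm (?f k t) \<partial>lborel) = cmod (g (int_decode k))" for k
    unfolding norm by simp
  then have summable_int: "summable (\<lambda>k. \<integral>t. norm (?f k t) \<partial>lborel)"
    using summable by (simp only:)
  have suminf: "(\<Sum>k. ?f k t) = indicator {0..1} t *\<^sub>R (h t * fourier_character t m)" for t
  proof (cases "t \<in> {0..1}")
    case True
    have "((\<lambda>n. cnj (fourier_character t n) * g n * fourier_character t m) has_sum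
        h t * fourier_character t m) UNIV"
      by (rule has_sum_cmult_left[OF h[OF True]])
    then have "((\<lambda>k. cnj (fourier_character t (int_decode k)) * g (int_decode k) * fourier_character t m)
        has_sum h t * fourier_character t m) UNIV"
      by (rule iffD2[OF has_sum_reindex_bij_betw[OF bij_int_decode]])
    then have sums: "(\<lambda>k. cnj (fourier_character t (int_decode k)) * g (int_decode k) * fourier_character t m)
        sums (h t * fourier_character t m)"
      by (rule has_sum_imp_sums)
    have "cnj (fourier_character t (int_decode k)) * g (int_decode k) * fourier_character t m = ?f k t" for k
      using True by (simp add: fourier_character_mult[symmetric] mult_ac)
    with sums have "?f k t = ?f k t \<and> (\<lambda>k. ?f k t) sums (h t * fourier_character t m)" for k
      by (simp only:)
    then have "(\<lambda>k. ?f k t) sums (h t * fourier_character t m)" by blast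
    with True show ?thesis by (simp add: sums_iff)
  qed simp
  have "integrable lborel (\<lambda>t. \<Sum>k. ?f k t)"
    by (rule integrable_suminf[OF int summable_f summable_int])
  then show "set_integrable lborel {0..1} (\<lambda>t. h t * fourier_character t m)"
    by (simp only: suminf set_integrable_def)
  have "(\<lambda>k. \<integral>t. ?f k t \<partial>lborel) sums (\<integral>t. (\<Sum>k. ?f k t) \<partial>lborel)"
    by (rule sums_integral[OF int summable_f summable_int])
  moreover have "(\<integral>t. ?f k t \<partial>lborel) = (if k = int_encode m then g (int_decode k) else 0)" for k
    using has_bochner_integral_integral_eq[OF f[of k]] by auto
  ultimately have "(\<lambda>k. if k = int_encode m then g (int_decode k) else 0)
      sums (LBINT t:{0..1}. h t * fourier_character t m)"
    by (simp only: suminf set_lebesgue_integral_def)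
  moreover have "(\<lambda>k. if k = int_encode m then g (int_decode k) else 0) sums g (int_decode (int_encode m))"
    by (rule sums_single)
  ultimately show "(LBINT t:{0..1}. h t * fourier_character t m) = g m"
    using sums_unique2 by fastforce
qed

lemma bessel_expansion_fourier_coefficient:
  assumes a: "a > 0" and b: "bessel_expansion a b h"
  shows "set_integrable lborel {0..1} (\<lambda>t. h t * exp (\<i> * of_real (t * 2 * pi * of_int n)))"
    and "(LBINT t:{0..1}. h t * exp (\<i> * of_real (t * 2 * pi * of_int n)))
      = b n * of_real (spectral_weight a n)"
proof -
  interpret finite_measure "spectral_measure a" by (rule finite_measure_spectral_measure[OF a])
  from integrable_square_integrable[OF bessel_expansion_square_integrable[OF a b]]
  have abs: "(\<lambda>n. cmod (b n * of_real (spectral_weight a n))) summable_on UNIV"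
    unfolding integrable_spectral_measure_iff[OF a] by (simp add: norm_mult mult.commute)
  have "((\<lambda>n. cnj (fourier_character t n) * (b n * of_real (spectral_weight a n))) has_sum h t) UNIV"
    if "t \<in> {0..1}" for t
  proof -
    have "((\<lambda>n. exp (- (\<i> * of_real (t * 2 * pi * of_int n))) * b n *
        of_real (spectral_weight a n)) has_sum h t) UNIV"
      using b that unfolding bessel_expansion_def by (elim conjE) (rule bspec)
    then show ?thesis unfolding fourier_character_exp by (simp only: mult.assoc)
  qed
  from fourier_coefficient[OF abs this]
  show "set_integrable lborel {0..1} (\<lambda>t. h t * exp (\<i> * of_real (t * 2 * pi * of_int n)))"
    and "(LBINT t:{0..1}. h t * exp (\<i> * of_real (t * 2 * pi * of_int n)))
      = b n * of_real (spectral_weight a n)"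
    by (simp_all only: fourier_character_exp)
qed

lemma bessel_expansion_unique:
  assumes a: "a > 0" and b: "bessel_expansion a b h" and b': "bessel_expansion a b' h"
  shows "b = b'"
proof
  fix n
  have "b n * of_real (spectral_weight a n) = b' n * of_real (spectral_weight a n)"
    using bessel_expansion_fourier_coefficient(2)[OF a b, of n]
      bessel_expansion_fourier_coefficient(2)[OF a b', of n] by (rule trans[OF sym])
  then show "b n = b' n" using spectral_weight_pos[OF a, of n] by simp
qed

text \<open>
  The coefficients of the real part are the Hermitian part of \<open>b\<close>: conjugation reverses the sign of the
  frequencies, and the weights are symmetric.
\<close>

lemma bessel_expansion_Re:
  assumes a: "a > 0" and b: "bessel_expansion a b h"
  shows "bessel_expansion a (\<lambda>n. (b n + cnj (b (- n))) / 2) (\<lambda>t. of_real (Re (h t)))"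
  unfolding bessel_expansion_def
proof (intro conjI ballI)
  let ?b = "\<lambda>n. (b n + cnj (b (- n))) / 2"
  have sum: "(\<lambda>n. (cmod (b n))\<^sup>2 * spectral_weight a n) summable_on UNIV"
    using b unfolding bessel_expansion_def by (rule conjunct1)
  then have "(\<lambda>n. (cmod (b (- n)))\<^sup>2 * spectral_weight a (- n)) summable_on UNIV"
    unfolding summable_on_def has_sum_uminus_int[where f = "\<lambda>n. (cmod (b n))\<^sup>2 * spectral_weight a n"] .
  then have "(\<lambda>n. (cmod (cnj (b (- n))))\<^sup>2 * spectral_weight a n) summable_on UNIV"
    by (simp only: spectral_weight_minus complex_mod_cnj)
  then have "square_integrable (spectral_measure a) (\<lambda>n. (1/2) *\<^sub>R (b n + cnj (b (- n))))"
    using sum unfolding square_integrable_spectral_measure_iff[OF a, symmetric]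
    by (intro square_integrable_scaleR square_integrable_add)
  then show "(\<lambda>n. (cmod (?b n))\<^sup>2 * spectral_weight a n) summable_on UNIV"
    unfolding square_integrable_spectral_measure_iff[OF a] by (simp add: scaleR_conv_of_real)
  fix t :: real assume t: "t \<in> {0..1}"
  let ?g = "\<lambda>n. cnj (fourier_character t n) * b n * of_real (spectral_weight a n)"
  have g: "(?g has_sum h t) UNIV"
    using b t unfolding bessel_expansion_def fourier_character_exp by (elim conjE) (rule bspec)
  have "((\<lambda>n. cnj (?g (- n))) has_sum cnj (h t)) UNIV"
    by (rule iffD2[OF has_sum_uminus_int[where f = "\<lambda>n. cnj (?g n)"] iffD2[OF has_sum_cnj_iff g]])
  from has_sum_cmult_left[OF has_sum_add[OF g this], of "1/2"]
  have "((\<lambda>n. (?g n + cnj (?g (- n))) * (1/2)) has_sum (h t + cnj (h t)) * (1/2)) UNIV" .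
  moreover have "(?g n + cnj (?g (- n))) * (1/2)
      = cnj (fourier_character t n) * ?b n * of_real (spectral_weight a n)" for n
    by (simp add: fourier_character_minus spectral_weight_minus algebra_simps)
  moreover have "(h t + cnj (h t)) * (1/2) = of_real (Re (h t))"
    by (simp add: complex_eq_iff)
  ultimately show "((\<lambda>n. exp (- (\<i> * of_real (t * 2 * pi * of_int n))) * ?b n *
      of_real (spectral_weight a n)) has_sum of_real (Re (h t))) UNIV"
    by (simp only: fourier_character_exp)
qed

section \<open>The RKHS of the periodic process\<close>

text \<open>
  Differences of square-integrable functions are square-integrable, which supplies the integrability
  condition on the left-hand side.
\<close>

lemma process_closed_span_eq:
  assumes "\<And>t. t \<in> T \<Longrightarrow> square_integrable M (W t)"
  shows "process_closed_span M T W = closed_span M T W"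
proof -
  have span: "(\<exists>X\<in>process_span T W. P X) \<longleftrightarrow> (\<exists>F c. finite F \<and> F \<subseteq> T \<and> P (lincomb F c W))" for P
    unfolding process_span_def lincomb_def by auto
  have integrable: "integrable M (\<lambda>\<omega>. (L \<omega> - lincomb F c W \<omega>)\<^sup>2)"
    if "square_integrable M L" "F \<subseteq> T" for L F c
    using integrable_norm_squared[OF square_integrable_diff[OF that(1) square_integrable_lincomb[OF assms that(2)]]]
    by simp
  have "L \<in> process_closed_span M T W \<longleftrightarrow> L \<in> closed_span M T W" for L
  proof (cases "square_integrable M L")
    case True
    then have "integrable M (\<lambda>\<omega>. (L \<omega> - lincomb F c W \<omega>)\<^sup>2) \<longleftrightarrow> True" if "F \<subseteq> T" for F c
      using integrable that by simp
    with True show ?thesis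
      unfolding process_closed_span_def closed_span_def span mem_Collect_eq
      by (simp add: square_integrable_def cong: conj_cong)
  next
    case False
    then show ?thesis
      unfolding process_closed_span_def closed_span_def square_integrable_def mem_Collect_eq
        real_norm_def power2_abs by blast
  qed
  then show ?thesis by (rule set_eqI)
qed

locale periodic_process =
  fixes M :: "'w measure" and W :: "real \<Rightarrow> 'w \<Rightarrow> real" and a :: real
  assumes a: "a > 0"
    and process: "centered_gaussian_process M {0..1} W (periodic_kernel a)"
begin

lemma prob_space: "prob_space M"
  using process by (simp add: centered_gaussian_process_def gaussian_process_def)

lemma covariance:
  "s \<in> {0..1} \<Longrightarrow> t \<in> {0..1} \<Longrightarrow> (\<integral>\<omega>. W s \<omega> \<bullet> W t \<omega> \<partial>M) = periodic_kernel a s t"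
  using process by (simp add: centered_gaussian_process_def)

text \<open>
  The second moment is \<open>G\<^sub>a(t, t) = 1\<close>. A function that is not integrable has integral \<open>0\<close> by convention, so
  the squared variable is integrable.
\<close>

lemma square_integrable_process:
  assumes t: "t \<in> {0..1}"
  shows "square_integrable M (W t)"
proof -
  have "W t = (\<lambda>\<omega>. \<Sum>s\<in>{t}. 1 * W s \<omega>)" by simp
  moreover have "(\<lambda>\<omega>. \<Sum>s\<in>{t}. 1 * W s \<omega>) \<in> process_span {0..1} W"
    unfolding process_span_def mem_Collect_eq using t by (intro exI[of _ "{t}"] exI[of _ "\<lambda>_. 1"] conjI refl) simp_all
  ultimately have "W t \<in> process_span {0..1} W" by (simp only:)
  then have "gaussian_variable M (W t)"
    using process by (simp only: centered_gaussian_process_def gaussian_process_def)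
  then have meas: "W t \<in> borel_measurable M"
    by (simp only: gaussian_variable_def)
  have "(\<integral>\<omega>. W t \<omega> \<bullet> W t \<omega> \<partial>M) = 1"
    unfolding covariance[OF t t] by (simp add: periodic_kernel_def)
  then have "integrable M (\<lambda>\<omega>. W t \<omega> \<bullet> W t \<omega>)"
    using not_integrable_integral_eq by fastforce
  with meas show ?thesis
    by (simp add: square_integrable_def power2_eq_square)
qed

lemma rkhs_fun_eq: "rkhs_fun M {0..1} W L = (\<lambda>t\<in>{0..1}. \<integral>\<omega>. W t \<omega> \<bullet> L \<omega> \<partial>M)"
  by (simp add: rkhs_fun_def)

abbreviation "process_space \<equiv> closed_span M {0..1} W"
abbreviation "spectral_space \<equiv> closed_span (spectral_measure a) {0..1} fourier_character"

lemma process_closed_span: "process_closed_span M {0..1} W = process_space"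
  by (rule process_closed_span_eq[OF square_integrable_process])

lemma gram:
  "s \<in> {0..1} \<Longrightarrow> t \<in> {0..1} \<Longrightarrow> (\<integral>\<omega>. W s \<omega> \<bullet> W t \<omega> \<partial>M)
     = (\<integral>n. fourier_character s n \<bullet> fourier_character t n \<partial>spectral_measure a)"
  by (simp only: covariance fourier_character_gram[OF a])

text \<open>
  The isometry from the process to the sequences. Its values are Hermitian, which makes the inner
  products with the characters a Bessel expansion.
\<close>

lemma spectral_representation:
  assumes L: "L \<in> process_space"
  obtains b where "square_integrable (spectral_measure a) b" and "hermitian b"
    and "(\<integral>n. (cmod (b n))\<^sup>2 \<partial>spectral_measure a) = (\<integral>\<omega>. (L \<omega>)\<^sup>2 \<partial>M)"
    and "bessel_expansion a b (\<lambda>t. of_real (rkhs_fun M {0..1} W L t))"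
proof -
  obtain b where b: "b \<in> spectral_space"
    and norm: "(\<integral>n. (cmod (b n))\<^sup>2 \<partial>spectral_measure a) = (\<integral>\<omega>. (norm (L \<omega>))\<^sup>2 \<partial>M)"
    and inner: "\<And>t. t \<in> {0..1} \<Longrightarrow> (\<integral>n. fourier_character t n \<bullet> b n \<partial>spectral_measure a)
      = (\<integral>\<omega>. W t \<omega> \<bullet> L \<omega> \<partial>M)"
    by (rule closed_span_isometry[OF finite_measure_spectral_measure[OF a] square_integrable_process
          square_integrable_fourier_character[OF a] gram L], assumption+, rule that)
  have sq: "square_integrable (spectral_measure a) b" using b by (simp add: closed_span_def)
  have herm: "hermitian b" by (rule hermitian_of_closed_span[OF a b])
  have expansion: "bessel_expansion a b (\<lambda>t. of_real (rkhs_fun M {0..1} W L t))"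
    by (rule bessel_expansion_cong[OF bessel_expansion_hermitian[OF a sq herm]])
      (simp only: rkhs_fun_eq restrict_apply' inner)
  show thesis
    by (rule that[OF sq herm _ expansion]) (use norm in simp)
qed

text \<open>
  The same isometry in the opposite direction. It applies to every square-integrable Hermitian
  sequence because all of these lie in the closed span of the characters.
\<close>

lemma spectral_synthesis:
  assumes b: "square_integrable (spectral_measure a) b" and herm: "hermitian b"
  obtains L where "L \<in> process_space"
    and "bessel_expansion a b (\<lambda>t. of_real (rkhs_fun M {0..1} W L t))"
proof -
  interpret prob_space M by (rule prob_space)
  obtain L where L: "L \<in> process_space"
    and inner: "\<And>t. t \<in> {0..1} \<Longrightarrow> (\<integral>\<omega>. W t \<omega> \<bullet> L \<omega> \<partial>M)
      = (\<integral>n. fourier_character t n \<bullet> b n \<partial>spectral_measure a)"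
    by (rule closed_span_isometry[OF finite_measure_axioms square_integrable_fourier_character[OF a]
          square_integrable_process gram[symmetric] hermitian_in_closed_span[OF a b herm]],
        assumption+, rule that)
  have "bessel_expansion a b (\<lambda>t. of_real (rkhs_fun M {0..1} W L t))"
    by (rule bessel_expansion_cong[OF bessel_expansion_hermitian[OF a b herm]])
      (simp only: rkhs_fun_eq restrict_apply' inner)
  with L show thesis by (rule that)
qed

text \<open>
  The difference of the variables represents the zero function. The zero function has only zero
  coefficients, and the isometry carries their norm back to the difference.
\<close>

lemma rkhs_fun_determines_variable:
  assumes X: "X \<in> process_space" and Y: "Y \<in> process_space"
    and eq: "rkhs_fun M {0..1} W X = rkhs_fun M {0..1} W Y"
  shows "(\<integral>\<omega>. (X \<omega> - Y \<omega>)\<^sup>2 \<partial>M) = 0"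
proof -
  let ?D = "\<lambda>\<omega>. X \<omega> - Y \<omega>"
  have D: "?D \<in> process_space"
    by (rule closed_span_diff[OF square_integrable_process X Y])
  have sX: "square_integrable M X" and sY: "square_integrable M Y"
    using X Y by (simp_all add: closed_span_def)
  have zero: "rkhs_fun M {0..1} W ?D t = 0" if t: "t \<in> {0..1}" for t
  proof -
    note W = square_integrable_process[OF t]
    have "(\<integral>\<omega>. W t \<omega> \<bullet> ?D \<omega> \<partial>M) = (\<integral>\<omega>. W t \<omega> \<bullet> X \<omega> \<partial>M) - (\<integral>\<omega>. W t \<omega> \<bullet> Y \<omega> \<partial>M)"
      unfolding inner_diff_right
      by (rule Bochner_Integration.integral_diff[OF integrable_inner[OF W sX] integrable_inner[OF W sY]])
    moreover have "(\<integral>\<omega>. W t \<omega> \<bullet> X \<omega> \<partial>M) = (\<integral>\<omega>. W t \<omega> \<bullet> Y \<omega> \<partial>M)"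
      using fun_cong[OF eq, of t] t by (simp add: rkhs_fun_eq)
    ultimately show ?thesis using t by (simp only: rkhs_fun_eq restrict_apply' diff_self)
  qed
  obtain b where norm: "(\<integral>n. (cmod (b n))\<^sup>2 \<partial>spectral_measure a) = (\<integral>\<omega>. (?D \<omega>)\<^sup>2 \<partial>M)"
    and b: "bessel_expansion a b (\<lambda>t. of_real (rkhs_fun M {0..1} W ?D t))"
    by (rule spectral_representation[OF D]) (rule that)
  have "bessel_expansion a b (\<lambda>t. 0)"
    by (rule bessel_expansion_cong[OF b]) (simp only: zero of_real_0)
  moreover have "bessel_expansion a (\<lambda>n. 0) (\<lambda>t. 0)"
    by (simp add: bessel_expansion_def)
  ultimately have "b = (\<lambda>n. 0)" by (rule bessel_expansion_unique[OF a])
  with norm show ?thesis by simp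
qed

text \<open>
  Replacing a representing variable by another one changes it by an element of norm zero, which by
  Cauchy--Schwarz does not affect inner products. So the definite description in the definition of the
  inner product is well defined.
\<close>

lemma rkhs_norm_rkhs_fun:
  assumes L: "L \<in> process_space"
  shows "(rkhs_norm M {0..1} W (rkhs_fun M {0..1} W L))\<^sup>2 = (\<integral>\<omega>. (L \<omega>)\<^sup>2 \<partial>M)"
proof -
  have sq: "square_integrable M X" if "X \<in> process_space" for X
    using that by (simp add: closed_span_def)
  have inner_eq: "(\<integral>\<omega>. Z \<omega> * X \<omega> \<partial>M) = (\<integral>\<omega>. Z \<omega> * Y \<omega> \<partial>M)"
    if X: "X \<in> process_space" and Y: "Y \<in> process_space" and Z: "Z \<in> process_space"
      and eq: "rkhs_fun M {0..1} W X = rkhs_fun M {0..1} W Y" for X Y Z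
  proof -
    have "(\<integral>\<omega>. Z \<omega> \<bullet> (X \<omega> - Y \<omega>) \<partial>M)\<^sup>2
        \<le> (\<integral>\<omega>. (norm (Z \<omega>))\<^sup>2 \<partial>M) * (\<integral>\<omega>. (norm (X \<omega> - Y \<omega>))\<^sup>2 \<partial>M)"
      by (rule Cauchy_Schwarz_integral[OF sq[OF Z] square_integrable_diff[OF sq[OF X] sq[OF Y]]])
    also have "\<dots> = 0" using rkhs_fun_determines_variable[OF X Y eq] by simp
    finally have "(\<integral>\<omega>. Z \<omega> \<bullet> (X \<omega> - Y \<omega>) \<partial>M) = 0" by simp
    moreover have "(\<integral>\<omega>. Z \<omega> \<bullet> (X \<omega> - Y \<omega>) \<partial>M) = (\<integral>\<omega>. Z \<omega> \<bullet> X \<omega> \<partial>M) - (\<integral>\<omega>. Z \<omega> \<bullet> Y \<omega> \<partial>M)"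
      unfolding inner_diff_right
      by (rule Bochner_Integration.integral_diff
          [OF integrable_inner[OF sq[OF Z] sq[OF X]] integrable_inner[OF sq[OF Z] sq[OF Y]]])
    ultimately show ?thesis by simp
  qed
  let ?h = "rkhs_fun M {0..1} W L"
  have "rkhs_inner M {0..1} W ?h ?h = (\<integral>\<omega>. L \<omega> * L \<omega> \<partial>M)"
    unfolding rkhs_inner_def process_closed_span
  proof (rule the_equality)
    show "\<exists>X\<in>process_space. \<exists>Y\<in>process_space. ?h = rkhs_fun M {0..1} W X \<and>
        ?h = rkhs_fun M {0..1} W Y \<and> (\<integral>\<omega>. L \<omega> * L \<omega> \<partial>M) = (\<integral>\<omega>. X \<omega> * Y \<omega> \<partial>M)"
      by (intro bexI[OF _ L] conjI refl)
    fix r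
    assume "\<exists>X\<in>process_space. \<exists>Y\<in>process_space. ?h = rkhs_fun M {0..1} W X \<and>
        ?h = rkhs_fun M {0..1} W Y \<and> r = (\<integral>\<omega>. X \<omega> * Y \<omega> \<partial>M)"
    then obtain X Y where X: "X \<in> process_space" "?h = rkhs_fun M {0..1} W X"
      and Y: "Y \<in> process_space" "?h = rkhs_fun M {0..1} W Y" and r: "r = (\<integral>\<omega>. X \<omega> * Y \<omega> \<partial>M)"
      by (elim bexE conjE) (rule that)
    have "r = (\<integral>\<omega>. X \<omega> * L \<omega> \<partial>M)"
      unfolding r by (rule inner_eq[OF Y(1) L X(1) Y(2)[symmetric]])
    also have "\<dots> = (\<integral>\<omega>. L \<omega> * X \<omega> \<partial>M)" by (simp only: mult.commute)
    also have "\<dots> = (\<integral>\<omega>. L \<omega> * L \<omega> \<partial>M)"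
      by (rule inner_eq[OF X(1) L L X(2)[symmetric]])
    finally show "r = (\<integral>\<omega>. L \<omega> * L \<omega> \<partial>M)" .
  qed
  then show ?thesis by (simp add: rkhs_norm_def power2_eq_square)
qed

lemma rkhs_eq: "rkhs M {0..1} W = (\<lambda>h. \<lambda>t\<in>{0..1}. Re (h t)) ` bessel_space a"
proof (intro equalityI subsetI)
  fix h assume "h \<in> rkhs M {0..1} W"
  then obtain L where L: "L \<in> process_space" and h: "h = rkhs_fun M {0..1} W L"
    unfolding rkhs_def process_closed_span by (elim imageE) (rule that)
  obtain b where b: "bessel_expansion a b (\<lambda>t. of_real (rkhs_fun M {0..1} W L t))"
    by (rule spectral_representation[OF L]) (rule that)
  let ?g = "\<lambda>t\<in>{0..1}. complex_of_real (h t)"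
  show "h \<in> (\<lambda>h. \<lambda>t\<in>{0..1}. Re (h t)) ` bessel_space a"
  proof (rule image_eqI)
    show "h = (\<lambda>t\<in>{0..1}. Re (?g t))"
      by (rule ext) (simp add: h rkhs_fun_eq restrict_def)
    have "bessel_expansion a b ?g"
      by (rule bessel_expansion_cong[OF b]) (simp only: h restrict_apply')
    then show "?g \<in> bessel_space a" unfolding bessel_space_def by blast
  qed
next
  fix h assume "h \<in> (\<lambda>h. \<lambda>t\<in>{0..1}. Re (h t)) ` bessel_space a"
  then obtain g b where g: "bessel_expansion a b g" and h: "h = (\<lambda>t\<in>{0..1}. Re (g t))"
    unfolding bessel_space_def by blast
  let ?b = "\<lambda>n. (b n + cnj (b (- n))) / 2"
  have expansion: "bessel_expansion a ?b (\<lambda>t. of_real (Re (g t)))"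
    by (rule bessel_expansion_Re[OF a g])
  have "hermitian ?b" by (simp add: hermitian_def add.commute)
  then obtain L where L: "L \<in> process_space"
    and expansion': "bessel_expansion a ?b (\<lambda>t. of_real (rkhs_fun M {0..1} W L t))"
    by (rule spectral_synthesis[OF bessel_expansion_square_integrable[OF a expansion]]) (rule that)
  have "complex_of_real (rkhs_fun M {0..1} W L t) = of_real (Re (g t))" if t: "t \<in> {0..1}" for t
    by (rule bessel_expansion_eqD[OF expansion' expansion t])
  then have "rkhs_fun M {0..1} W L = h"
    by (intro ext) (simp add: h rkhs_fun_eq restrict_def)
  with L show "h \<in> rkhs M {0..1} W"
    unfolding rkhs_def process_closed_span by blast
qed

lemma rkhs_norm_has_sum:
  assumes h: "h \<in> rkhs M {0..1} W" and b: "bessel_expansion a b (\<lambda>t. complex_of_real (h t))"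
  shows "((\<lambda>n. (cmod (b n))\<^sup>2 * spectral_weight a n) has_sum (rkhs_norm M {0..1} W h)\<^sup>2) UNIV"
proof -
  obtain L where L: "L \<in> process_space" and hL: "h = rkhs_fun M {0..1} W L"
    using h unfolding rkhs_def process_closed_span by (elim imageE) (rule that)
  obtain b' where sq: "square_integrable (spectral_measure a) b'"
    and norm: "(\<integral>n. (cmod (b' n))\<^sup>2 \<partial>spectral_measure a) = (\<integral>\<omega>. (L \<omega>)\<^sup>2 \<partial>M)"
    and expansion: "bessel_expansion a b' (\<lambda>t. of_real (rkhs_fun M {0..1} W L t))"
    by (rule spectral_representation[OF L]) (rule that)
  have "b = b'"
    by (rule bessel_expansion_unique[OF a b]) (simp only: hL expansion)
  then show ?thesis
    using square_integrable_spectral_measure_has_sum[OF a sq]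
    by (simp only: hL rkhs_norm_rkhs_fun[OF L] norm)
qed

end

theorem lemma4p3:
  fixes M :: "'w measure" and W :: "real \<Rightarrow> 'w \<Rightarrow> real" and a :: real
  assumes "a > 0"
    and "centered_gaussian_process M {0..1} W (periodic_kernel a)"
  shows "rkhs M {0..1} W = (\<lambda>h. \<lambda>t\<in>{0..1}. Re (h t)) ` bessel_space a \<and>
    (\<forall>h\<in>rkhs M {0..1} W.
       (\<exists>b. bessel_expansion a b (\<lambda>t. complex_of_real (h t))) \<and>
       (\<forall>b. bessel_expansion a b (\<lambda>t. complex_of_real (h t)) \<longrightarrow>
          ((\<lambda>n. (cmod (b n))\<^sup>2 * spectral_weight a n) has_sum (rkhs_norm M {0..1} W h)\<^sup>2) UNIV) \<and>
       (\<forall>n::int. set_integrable lborel {0..1}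
          (\<lambda>t. complex_of_real (h t) * exp (\<i> * of_real (t * 2 * pi * of_int n)))) \<and>
       ((\<lambda>n::int. 1 / spectral_weight a n *
          (cmod (LBINT t:{0..1}. complex_of_real (h t) * exp (\<i> * of_real (t * 2 * pi * of_int n))))\<^sup>2)
        has_sum (rkhs_norm M {0..1} W h)\<^sup>2) UNIV)"
proof -
  interpret periodic_process M W a by (rule periodic_process.intro[OF assms])
  show ?thesis
  proof (intro conjI ballI)
    show "rkhs M {0..1} W = (\<lambda>h. \<lambda>t\<in>{0..1}. Re (h t)) ` bessel_space a" by (rule rkhs_eq)
    fix h assume h: "h \<in> rkhs M {0..1} W"
    obtain L where L: "L \<in> process_space" and hL: "h = rkhs_fun M {0..1} W L"
      using h unfolding rkhs_def process_closed_span by (elim imageE) (rule that)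
    obtain b where "bessel_expansion a b (\<lambda>t. complex_of_real (rkhs_fun M {0..1} W L t))"
      by (rule spectral_representation[OF L]) (rule that)
    then have b: "bessel_expansion a b (\<lambda>t. complex_of_real (h t))"
      by (simp only: hL)
    show "\<exists>b. bessel_expansion a b (\<lambda>t. complex_of_real (h t))"
      by (intro exI[of _ b] b)
    show "\<forall>b. bessel_expansion a b (\<lambda>t. complex_of_real (h t)) \<longrightarrow>
        ((\<lambda>n. (cmod (b n))\<^sup>2 * spectral_weight a n) has_sum (rkhs_norm M {0..1} W h)\<^sup>2) UNIV"
      by (intro allI impI rkhs_norm_has_sum[OF h])
    show "\<forall>n::int. set_integrable lborel {0..1}
        (\<lambda>t. complex_of_real (h t) * exp (\<i> * of_real (t * 2 * pi * of_int n)))"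
      by (intro allI bessel_expansion_fourier_coefficient(1)[OF a b])
    have "1 / spectral_weight a n *
          (cmod (LBINT t:{0..1}. complex_of_real (h t) * exp (\<i> * of_real (t * 2 * pi * of_int n))))\<^sup>2
        = (cmod (b n))\<^sup>2 * spectral_weight a n" for n
      unfolding bessel_expansion_fourier_coefficient(2)[OF a b]
      using spectral_weight_pos[OF a, of n]
      by (simp add: norm_mult power_mult_distrib power2_eq_square)
    then show "((\<lambda>n::int. 1 / spectral_weight a n *
          (cmod (LBINT t:{0..1}. complex_of_real (h t) * exp (\<i> * of_real (t * 2 * pi * of_int n))))\<^sup>2)
        has_sum (rkhs_norm M {0..1} W h)\<^sup>2) UNIV"
      using rkhs_norm_has_sum[OF h b] by (simp only:)
  qed
qed

end
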